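(* Let $n$ be a positive integer, let $f,h:[0,1]^n\to\mathbb{R}$ be twice continuously differentiable functions, and let $t>0$. Put $a=\Vert f\Vert$, $b_i=\Vert f_i\Vert$, $c_{ij}=\Vert f_{ij}\Vert$ and $\alpha=\Vert h\Vert$, $\beta_i=\Vert h_i\Vert$, $\gamma_{ij}=\Vert h_{ij}\Vert$ for $1\le i,j\le n$. For every $\epsilon>0$, let $\mathcal{D}_f(\epsilon)$ and $\mathcal{D}_h(\epsilon)$ be finite subsets of $\mathbb{R}^n$ such that for all $x\in[0,1]^n$ there exist $d\in\mathcal{D}_f(\epsilon)$ with $\sum_{i=1}^n (f_i(x)-d_i)^2\le n\epsilon^2$ and $d'\in\mathcal{D}_h(\epsilon)$ with $\sum_{i=1}^n (h_i(x)-d'_i)^2\le n\epsilon^2$. Let $$F^c=\log\sum_{x\in\{0,1\}^n:\,|h(x)|\le tn}e^{f(x)},\qquad K=\log 2+\frac{2a}{n}.$$ Then for any $\delta>0$ and $\epsilon>0$, $$F^c\le \sup_{x\in[0,1]^n:\,|h(x)|\le (t+\delta)n}\bigl(f(x)-I(x)\bigr)+\mathcal{C}+\mathcal{S},$$ where the complexity term is $$\mathcal{C}=\frac14\Bigl(n\sum_{i=1}^n m_i^2\Bigr)^{1/2}\epsilon+3n\epsilon+\log\left(\frac{12K\left(\frac1n\sum_{i=1}^n\beta_i^2\right)^{1/2}}{\delta\epsilon}\right)+\log|\mathcal{D}_f(\epsilon/3)|+\log|\mathcal{D}_h((\delta\epsilon)/(6K))|,$$ the smoothness term is $$\mathcal{S}=4\Bigl(\sum_{i=1}^n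 (l\,n_{ii}+m_i^2)+\frac14\sum_{i,j=1}^n (l\,n_{ij}^2+m_im_jn_{ij}+4m_in_{ij})\Bigr)^{1/2}+\frac14\Bigl(\sum_{i=1}^n m_i^2\Bigr)^{1/2}\Bigl(\sum_{i=1}^n n_{ii}^2\Bigr)^{1/2}+3\sum_{i=1}^n n_{ii}+\log 2,$$ and $$l=a+nK,\qquad m_i=b_i+\frac{2K\beta_i}{\delta},\qquad n_{ij}=c_{ij}+\frac{2K\gamma_{ij}}{\delta}+\frac{6K\beta_i\beta_j}{n\delta^2}.$$ Moreover, $$F^c\ge \sup_{x\in[0,1]^n:\,|h(x)|\le (t-\delta_0)n}\bigl(f(x)-I(x)\bigr)-\epsilon_0 n-\eta_0 n-\log 2,$$ where $$\delta_0=\frac{\sqrt6}{n}\Bigl(\sum_{i=1}^n(\alpha\gamma_{ii}+\beta_i^2)\Bigr)^{1/2},\qquad \epsilon_0=2\sqrt{\frac6n},\qquad \eta_0=\frac{\sqrt6}{n}\Bigl(\sum_{i=1}^n(ac_{ii}+b_i^2)\Bigr)^{1/2}.$$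
   Context: $\Vert\cdot\Vert$ denotes the supremum norm over $[0,1]^n$. For a twice continuously differentiable function $f$ on $[0,1]^n$, $f_i=\partial f/\partial x_i$ and $f_{ij}=\partial^2 f/\partial x_i\partial x_j$ (similarly for $h$). For $x=(x_1,\dots,x_n)\in[0,1]^n$, $I(x)=\sum_{i=1}^n\bigl(x_i\log x_i+(1-x_i)\log(1-x_i)\bigr)$, with $0\log 0=0$. $|\mathcal{D}|$ denotes the cardinality of a finite set $\mathcal{D}$. A supremum over the empty set is $-\infty$, and $F^c=-\infty$ if no $x\in\{0,1\}^n$ satisfies $|h(x)|\le tn$.
   Formalization: In the complexity term, log(y) with y = 12K((1/n)Σβ_i²)^{1/2}/(δε) is replaced by log(max(1,y)); as written the upper bound fails, e.g. n=t=δ=ε=1, f=0, h(x)=sx, D_f={0}, D_h={s} with s>0 small. *)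

theory Defs
  imports "HOL-Analysis.Analysis"
begin

definition unit_cube :: "(real ^ 'n) set" where
  "unit_cube = {x. \<forall>i. 0 \<le> x $ i \<and> x $ i \<le> 1}"

definition cube_vertices :: "(real ^ 'n) set" where
  "cube_vertices = {x. \<forall>i. x $ i = 0 \<or> x $ i = 1}"

definition sup_norm :: "(real ^ 'n \<Rightarrow> real) \<Rightarrow> real" where
  "sup_norm g = (SUP x\<in>unit_cube. \<bar>g x\<bar>)"

(* Derivatives are taken within the closed cube (one-sided on its boundary), where the
   Frechet derivative is unique; hence only the values of g on the cube matter. *)
definition partial :: "'n \<Rightarrow> (real ^ 'n \<Rightarrow> real) \<Rightarrow> real ^ 'n \<Rightarrow> real" where
  "partial i g x = frechet_derivative g (at x within unit_cube) (axis i 1)"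

definition partial2 :: "'n \<Rightarrow> 'n \<Rightarrow> (real ^ 'n \<Rightarrow> real) \<Rightarrow> real ^ 'n \<Rightarrow> real" where
  "partial2 i j g = partial i (partial j g)"

definition C2_on_cube :: "(real ^ 'n \<Rightarrow> real) \<Rightarrow> bool" where
  "C2_on_cube g \<longleftrightarrow>
     g differentiable_on unit_cube \<and>
     (\<forall>i. continuous_on unit_cube (partial i g)) \<and>
     (\<forall>i. partial i g differentiable_on unit_cube) \<and>
     (\<forall>i j. continuous_on unit_cube (partial2 i j g))"

(* 0 log 0 = 0 holds because of the factor 0. *)
definition entropy_I :: "real ^ 'n \<Rightarrow> real" where
  "entropy_I x = (\<Sum>i\<in>UNIV. x $ i * ln (x $ i) + (1 - x $ i) * ln (1 - x $ i))"

definition gradient_net :: "(real ^ 'n \<Rightarrow> real) \<Rightarrow> real \<Rightarrow> (real ^ 'n) set \<Rightarrow> bool" where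
  "gradient_net g \<epsilon> D \<longleftrightarrow>
     finite D \<and>
     (\<forall>x\<in>unit_cube. \<exists>d\<in>D. (\<Sum>i\<in>UNIV. (partial i g x - d $ i)\<^sup>2) \<le> real CARD('n) * \<epsilon>\<^sup>2)"

definition constrained_free_energy ::
  "(real ^ 'n \<Rightarrow> real) \<Rightarrow> (real ^ 'n \<Rightarrow> real) \<Rightarrow> real \<Rightarrow> ereal" where
  "constrained_free_energy f h t =
     (let A = {x \<in> cube_vertices. \<bar>h x\<bar> \<le> t * real CARD('n)}
      in if A = {} then -\<infinity> else ereal (ln (\<Sum>x\<in>A. exp (f x))))"

(* The supremum is taken in the extended reals, so it is -\<infinity> over the empty set. *)
definition constrained_sup ::
  "(real ^ 'n \<Rightarrow> real) \<Rightarrow> (real ^ 'n \<Rightarrow> real) \<Rightarrow> real \<Rightarrow> ereal" where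
  "constrained_sup f h s =
     (SUP x \<in> {x \<in> unit_cube. \<bar>h x\<bar> \<le> s * real CARD('n)}. ereal (f x - entropy_I x))"

(* The logarithm truncated below at 0.  In the upper bound it is applied to
   y = 12 K (1/n sum_i beta_i^2)^(1/2) / (delta epsilon), which bounds the size of a
   one-dimensional grid.  A nonempty grid has at least one point, so for y < 1 the bound
   has to be read with y replaced by 1: with a plain logarithm (-\<infinity> at 0) the upper
   bound fails for n = t = delta = epsilon = 1, f = 0, h(x) = s x as s > 0 tends to 0. *)
definition log_plus :: "real \<Rightarrow> real" where
  "log_plus y = ln (max 1 y)"

end

theory Submission
  imports Defs
begin

text \<open>
  Both bounds compare the sum of \<open>exp f\<close> over the admissible vertices with product
  measures on the vertices of the cube, whose log-density is affine and whose entropy is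
  \<open>- entropy_I\<close> of their mean.

  Upper bound.  The hard constraint is traded for a penalty: let
  \<open>g = f - n * K * P \<circ> h\<close>, where \<open>P\<close> vanishes on \<open>[-t n, t n]\<close>, equals 1 outside
  \<open>[-(t + \<delta>) n, (t + \<delta>) n]\<close> and has a Lipschitz derivative.  Admissible vertices are not
  penalised, and \<open>K\<close> is so large that points with \<open>\<bar>h\<bar> > (t + \<delta>) n\<close> cannot compete in the
  supremum of \<open>g - entropy_I\<close> (theorem \<open>constrained_mean_field_upper_bound\<close>).  It remains to
  bound the free energy of \<open>g\<close> by its mean-field value (theorem \<open>mean_field_upper_bound\<close>).

  Let \<open>X\<close> have the Gibbs law \<open>w x = exp (g x) / Z\<close>.  If every vertex \<open>x\<close> chooses one of
  \<open>card D\<close> probability laws \<open>q d\<close>, then Jensen's inequality gives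
  \<open>ln Z \<le> ln (card D) + E (g X - ln (q (d X) X))\<close> (lemma \<open>gibbs_coding_bound\<close>).  Here the laws
  are product measures whose logits are the points of a net for the gradient of \<open>g\<close>, and \<open>d x\<close>
  is a net point close to the gradient at \<open>x\<close>.  Let \<open>p i x\<close> be the conditional probability
  that coordinate \<open>i\<close> is 1 given the other coordinates; its logit is the difference
  \<open>\<Delta> i x\<close> of \<open>g\<close> in direction \<open>i\<close>, which is close to the \<open>i\<close>-th partial derivative.  Let
  \<open>\<mu> x\<close> be the vector of the \<open>p i x\<close>.  Since the logits determine the entropy, replacing
  \<open>- ln (q (d X) X)\<close> by \<open>- entropy_I (\<mu> X)\<close> costs only the distance between the logits and a
  linear term \<open>\<Sum>i. (X i - p i X) * \<Delta> i X\<close> of mean exactly zero.  What is left is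
  \<open>E (g X - g (\<mu> X))\<close>.  Differentiating along the segment from \<open>\<mu> X\<close> to \<open>X\<close> and using that
  \<open>X i - p i X\<close> is conditionally centred, this is at most a multiple of
  \<open>\<Sum>i. N i i + \<Sum>i j. (N i j)\<^sup>2\<close>; it is also at most \<open>2 l\<close>, and the geometric mean
  of the two bounds produces the square root in the smoothness term.

  The gradient of \<open>g\<close> at \<open>x\<close> is that of \<open>f\<close> minus a scalar in \<open>[-2 K / \<delta>, 2 K / \<delta>]\<close>
  times that of \<open>h\<close>.  So its net is assembled from the two given nets and a grid in that
  interval, which is where \<open>log_plus\<close> comes from (lemma \<open>interval_net\<close>).

  Lower bound.  For \<open>y\<close> in the cube let \<open>Y\<close> have independent Bernoulli coordinates with mean
  \<open>y\<close>.  Replacing the coordinates of \<open>y\<close> by those of \<open>Y\<close> one at a time bounds the second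
  moments of \<open>f Y - f y\<close>, \<open>h Y - h y\<close> and of the log-density minus \<open>entropy_I y\<close>.  By
  Chebyshev each of the three exceeds \<open>sqrt 6\<close> times the square root of its bound with
  probability at most 1/6.  Hence with probability at least 1/2 the vertex \<open>Y\<close> is
  admissible and \<open>f Y\<close> minus the log-density is nearly \<open>f y - entropy_I y\<close>; summing over
  these vertices gives the claim (theorem \<open>mean_field_lower_bound\<close>).
\<close>

section \<open>Calculus on the cube\<close>

lemma unit_cube_eq_cbox: "unit_cube = cbox (0 :: real ^ 'n) 1"
  by (auto simp: unit_cube_def mem_box_cart)

lemma convex_unit_cube: "convex (unit_cube :: (real ^ 'n) set)"
  by (simp add: unit_cube_eq_cbox convex_box)

lemma compact_unit_cube: "compact (unit_cube :: (real ^ 'n) set)"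
  by (simp add: unit_cube_eq_cbox)

lemma line_in_unit_cube:
  fixes y z :: "real ^ 'n"
  assumes "y \<in> unit_cube" "z \<in> unit_cube" "s \<in> {0..1}"
  shows "y + s *\<^sub>R (z - y) \<in> unit_cube"
proof -
  have "(1 - s) *\<^sub>R y + s *\<^sub>R z \<in> unit_cube"
    using convexD[OF convex_unit_cube assms(1,2), of "1 - s" s] assms(3) by auto
  then show ?thesis
    by (simp add: algebra_simps)
qed

lemma abs_le_sup_norm:
  assumes "continuous_on unit_cube g" "x \<in> unit_cube"
  shows "\<bar>g x\<bar> \<le> sup_norm g"
proof -
  have "compact ((\<lambda>x. \<bar>g x\<bar>) ` unit_cube)"
    by (intro compact_continuous_image continuous_intros assms compact_unit_cube)
  then have "bdd_above ((\<lambda>x. \<bar>g x\<bar>) ` unit_cube)"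
    by (intro bounded_imp_bdd_above compact_imp_bounded)
  then show ?thesis
    unfolding sup_norm_def using assms(2) by (intro cSUP_upper)
qed

lemma zero_in_unit_cube: "0 \<in> unit_cube"
  by (simp add: unit_cube_def)

lemma sup_norm_nonneg:
  assumes "continuous_on unit_cube g"
  shows "0 \<le> sup_norm g"
  using abs_le_sup_norm[OF assms zero_in_unit_cube] by linarith

text \<open>
  The derivative is taken within the closed cube, so that \<open>partial\<close> fits this notion at
  boundary points as well; every mean value argument below stays inside the cube.
\<close>

definition has_gradient :: "(real ^ 'n \<Rightarrow> real) \<Rightarrow> ('n \<Rightarrow> real ^ 'n \<Rightarrow> real) \<Rightarrow> bool" where
  "has_gradient g G \<longleftrightarrow>
     (\<forall>x\<in>unit_cube. (g has_derivative (\<lambda>v. \<Sum>i\<in>UNIV. G i x * v $ i)) (at x within unit_cube))"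

lemma has_gradient_partial:
  fixes g :: "real ^ 'n \<Rightarrow> real"
  assumes "g differentiable_on unit_cube"
  shows "has_gradient g (\<lambda>i. partial i g)"
  unfolding has_gradient_def
proof
  fix x :: "real ^ 'n"
  assume x: "x \<in> unit_cube"
  let ?D = "frechet_derivative g (at x within unit_cube)"
  have D: "(g has_derivative ?D) (at x within unit_cube)"
    using assms x by (simp add: differentiable_on_def frechet_derivative_works)
  have lin: "linear ?D"
    using D by (rule has_derivative_linear)
  have "?D v = (\<Sum>i\<in>UNIV. partial i g x * v $ i)" for v
  proof -
    have "?D v = ?D (\<Sum>i\<in>UNIV. (v $ i) *\<^sub>R axis i 1)"
      by (subst basis_expansion[symmetric]) (simp add: scalar_mult_eq_scaleR)
    also have "\<dots> = (\<Sum>i\<in>UNIV. v $ i * partial i g x)"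
      by (simp add: linear_sum[OF lin] linear_scale[OF lin] partial_def)
    finally show ?thesis by (simp add: mult.commute)
  qed
  then have "?D = (\<lambda>v. \<Sum>i\<in>UNIV. partial i g x * v $ i)" ..
  with D show "(g has_derivative (\<lambda>v. \<Sum>i\<in>UNIV. partial i g x * v $ i)) (at x within unit_cube)"
    by simp
qed

lemma has_gradient_on_line:
  assumes g: "has_gradient g G" and y: "y \<in> unit_cube" and z: "z \<in> unit_cube" and s: "s \<in> {0..1}"
  shows "((\<lambda>s. g (y + s *\<^sub>R (z - y))) has_real_derivative
           (\<Sum>i\<in>UNIV. G i (y + s *\<^sub>R (z - y)) * (z $ i - y $ i))) (at s within {0..1})"
proof -
  let ?L = "\<lambda>s. y + s *\<^sub>R (z - y)"
  have sub: "?L ` {0..1} \<subseteq> unit_cube"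
    using line_in_unit_cube[OF y z] by auto
  have "(g has_derivative (\<lambda>v. \<Sum>i\<in>UNIV. G i (?L s) * v $ i)) (at (?L s) within ?L ` {0..1})"
    using g line_in_unit_cube[OF y z s] sub unfolding has_gradient_def
    by (blast intro: has_derivative_subset)
  moreover have "(?L has_derivative (\<lambda>r. r *\<^sub>R (z - y))) (at s within {0..1})"
    by (auto intro!: derivative_eq_intros)
  ultimately have "((\<lambda>s. g (?L s)) has_derivative
      (\<lambda>r. \<Sum>i\<in>UNIV. G i (?L s) * (r *\<^sub>R (z - y)) $ i)) (at s within {0..1})"
    using has_derivative_in_compose by fastforce
  moreover have "(\<lambda>r. \<Sum>i\<in>UNIV. G i (?L s) * (r *\<^sub>R (z - y)) $ i)
      = (*) (\<Sum>i\<in>UNIV. G i (?L s) * (z $ i - y $ i))"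
    by (auto simp: sum_distrib_left sum_distrib_right mult_ac intro!: ext sum.cong)
  ultimately show ?thesis
    by (simp add: has_field_derivative_def)
qed

lemma mean_value_unit_interval:
  fixes u :: "real \<Rightarrow> real"
  assumes "\<And>s. s \<in> {0..1} \<Longrightarrow> (u has_real_derivative u' s) (at s within {0..1})"
  shows "\<exists>s\<in>{0..1}. u 1 - u 0 = u' s"
  using mvt_very_simple[of 0 1 u "\<lambda>s h. u' s * h"] assms
  by (auto simp: has_field_derivative_def)

lemma mean_value_on_cube:
  assumes g: "has_gradient g G" and y: "y \<in> unit_cube" and z: "z \<in> unit_cube"
  shows "\<exists>s\<in>{0..1}. g z - g y = (\<Sum>i\<in>UNIV. G i (y + s *\<^sub>R (z - y)) * (z $ i - y $ i))"
  using mean_value_unit_interval[OF has_gradient_on_line[OF g y z]] by auto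

text \<open>
  One Lipschitz constant per coordinate, in the weighted \<open>l1\<close> sense.  Second derivatives
  enter the argument only through such bounds on first derivatives, so a penalty with a merely
  Lipschitz derivative is admissible.
\<close>

definition lipschitz_on_cube :: "('n \<Rightarrow> real) \<Rightarrow> (real ^ 'n \<Rightarrow> real) \<Rightarrow> bool" where
  "lipschitz_on_cube L g \<longleftrightarrow>
     (\<forall>y\<in>unit_cube. \<forall>z\<in>unit_cube. \<bar>g z - g y\<bar> \<le> (\<Sum>i\<in>UNIV. L i * \<bar>z $ i - y $ i\<bar>))"

lemma lipschitz_on_cubeD:
  "lipschitz_on_cube L g \<Longrightarrow> y \<in> unit_cube \<Longrightarrow> z \<in> unit_cube
     \<Longrightarrow> \<bar>g z - g y\<bar> \<le> (\<Sum>i\<in>UNIV. L i * \<bar>z $ i - y $ i\<bar>)"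
  by (simp add: lipschitz_on_cube_def)

lemma has_gradient_imp_lipschitz:
  fixes g :: "real ^ 'n \<Rightarrow> real"
  assumes g: "has_gradient g G" and bound: "\<And>i x. x \<in> unit_cube \<Longrightarrow> \<bar>G i x\<bar> \<le> L i"
  shows "lipschitz_on_cube L g"
  unfolding lipschitz_on_cube_def
proof (intro ballI)
  fix y z :: "real ^ 'n"
  assume y: "y \<in> unit_cube" and z: "z \<in> unit_cube"
  from mean_value_on_cube[OF g y z] obtain s where s: "s \<in> {0..1}"
    and eq: "g z - g y = (\<Sum>i\<in>UNIV. G i (y + s *\<^sub>R (z - y)) * (z $ i - y $ i))" by blast
  have "\<bar>g z - g y\<bar> \<le> (\<Sum>i\<in>UNIV. \<bar>G i (y + s *\<^sub>R (z - y)) * (z $ i - y $ i)\<bar>)"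
    unfolding eq by (rule sum_abs)
  also have "\<dots> \<le> (\<Sum>i\<in>UNIV. L i * \<bar>z $ i - y $ i\<bar>)"
    by (auto simp: abs_mult intro!: sum_mono mult_right_mono bound line_in_unit_cube y z s)
  finally show "\<bar>g z - g y\<bar> \<le> (\<Sum>i\<in>UNIV. L i * \<bar>z $ i - y $ i\<bar>)" .
qed

definition set_coord :: "real ^ 'n \<Rightarrow> 'n \<Rightarrow> real \<Rightarrow> real ^ 'n" where
  "set_coord x i s = (\<chi> j. if j = i then s else x $ j)"

lemma set_coord_nth [simp]: "set_coord x i s $ j = (if j = i then s else x $ j)"
  by (simp add: set_coord_def)

lemma set_coord_set_coord [simp]: "set_coord (set_coord x i s) i r = set_coord x i r"
  by (simp add: vec_eq_iff)

lemma set_coord_commute: "i \<noteq> j \<Longrightarrow> set_coord (set_coord x i s) j r = set_coord (set_coord x j r) i s"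
  by (simp add: vec_eq_iff)

lemma set_coord_in_cube: "x \<in> unit_cube \<Longrightarrow> s \<in> {0..1} \<Longrightarrow> set_coord x i s \<in> unit_cube"
  by (simp add: unit_cube_def)

lemma set_coord_line:
  "set_coord x i a + r *\<^sub>R (set_coord x i b - set_coord x i a) = set_coord x i (a + r * (b - a))"
  by (simp add: vec_eq_iff)

lemma mean_value_coord:
  assumes g: "has_gradient g G" and x: "x \<in> unit_cube" and ab: "a \<in> {0..1}" "b \<in> {0..1}" "a \<le> b"
  shows "\<exists>\<xi>\<in>{a..b}. g (set_coord x i b) - g (set_coord x i a) = (b - a) * G i (set_coord x i \<xi>)"
proof -
  from mean_value_on_cube[OF g set_coord_in_cube[OF x ab(1)] set_coord_in_cube[OF x ab(2)], of i i]
  obtain s where s: "s \<in> {0..1}" and eq: "g (set_coord x i b) - g (set_coord x i a) =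
      (\<Sum>j\<in>UNIV. G j (set_coord x i (a + s * (b - a))) * (set_coord x i b $ j - set_coord x i a $ j))"
    unfolding set_coord_line by blast
  have "(\<Sum>j\<in>UNIV. G j (set_coord x i (a + s * (b - a))) * (set_coord x i b $ j - set_coord x i a $ j))
      = (\<Sum>j\<in>UNIV. if j = i then (b - a) * G i (set_coord x i (a + s * (b - a))) else 0)"
    by (intro sum.cong) auto
  then have "g (set_coord x i b) - g (set_coord x i a) = (b - a) * G i (set_coord x i (a + s * (b - a)))"
    using eq by simp
  moreover have "a + s * (b - a) \<in> {a..b}"
    using s ab(3) mult_left_le_one_le[of "b - a" s] by auto
  ultimately show ?thesis by blast
qed

lemma lipschitz_coord:
  assumes "lipschitz_on_cube L g" and x: "x \<in> unit_cube" and "a \<in> {0..1}" "b \<in> {0..1}"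
  shows "\<bar>g (set_coord x i b) - g (set_coord x i a)\<bar> \<le> L i * \<bar>b - a\<bar>"
proof -
  have "\<bar>g (set_coord x i b) - g (set_coord x i a)\<bar>
      \<le> (\<Sum>j\<in>UNIV. L j * \<bar>set_coord x i b $ j - set_coord x i a $ j\<bar>)"
    using assms by (intro lipschitz_on_cubeD set_coord_in_cube)
  also have "\<dots> = (\<Sum>j\<in>UNIV. if j = i then L i * \<bar>b - a\<bar> else 0)"
    by (intro sum.cong) auto
  finally show ?thesis by simp
qed

text \<open>
  The mixed difference is the increment in \<open>s\<close> of \<open>g\<close> at coordinate \<open>j\<close> equal to 1 minus
  \<open>g\<close> at coordinate \<open>j\<close> equal to 0, where \<open>s\<close> is coordinate \<open>i\<close>.  The mean value theorem in
  \<open>s\<close> turns it into a difference of \<open>G i\<close> in direction \<open>j\<close>.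
\<close>

lemma second_difference_bound:
  assumes g: "has_gradient g G" and lip: "lipschitz_on_cube L (G i)"
    and x: "x \<in> unit_cube" and ij: "i \<noteq> j"
  shows "\<bar>(g (set_coord (set_coord x i 1) j 1) - g (set_coord (set_coord x i 1) j 0))
         - (g (set_coord (set_coord x i 0) j 1) - g (set_coord (set_coord x i 0) j 0))\<bar> \<le> L j"
proof -
  let ?p = "\<lambda>r s. set_coord (set_coord x j r) i s"
  have in_cube: "?p r s \<in> unit_cube" if "r \<in> {0..1}" "s \<in> {0..1}" for r s
    using that x by (intro set_coord_in_cube)
  have der: "((\<lambda>s. g (?p r s)) has_real_derivative G i (?p r s)) (at s within {0..1})"
    if "r \<in> {0..1}" "s \<in> {0..1}" for r s
  proof -
    have "(\<Sum>k\<in>UNIV. G k (?p r s) * (?p r 1 $ k - ?p r 0 $ k))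
        = (\<Sum>k\<in>UNIV. if k = i then G i (?p r s) else 0)"
      by (intro sum.cong) auto
    then show ?thesis
      using has_gradient_on_line[OF g in_cube[OF that(1), of 0] in_cube[OF that(1), of 1] that(2)]
      by (simp add: set_coord_line)
  qed
  have "((\<lambda>s. g (?p 1 s) - g (?p 0 s)) has_real_derivative G i (?p 1 s) - G i (?p 0 s)) (at s within {0..1})"
    if "s \<in> {0..1}" for s
    using that by (intro DERIV_diff der) auto
  from mean_value_unit_interval[OF this] obtain s where s: "s \<in> {0..1}"
    and eq: "(g (?p 1 1) - g (?p 0 1)) - (g (?p 1 0) - g (?p 0 0)) = G i (?p 1 s) - G i (?p 0 s)"
    by blast
  have "\<bar>G i (?p 1 s) - G i (?p 0 s)\<bar> \<le> L j * \<bar>1 - 0\<bar>"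
    unfolding set_coord_commute[OF ij[symmetric]]
    using s x lip by (intro lipschitz_coord set_coord_in_cube) auto
  then show ?thesis
    using eq by (simp add: set_coord_commute[OF ij])
qed

section \<open>Vertices and resampling of one coordinate\<close>

lemma cube_vertices_subset: "cube_vertices \<subseteq> unit_cube"
proof
  fix x :: "real ^ 'a"
  assume "x \<in> cube_vertices"
  then have "x $ i = 0 \<or> x $ i = 1" for i
    by (simp add: cube_vertices_def)
  then have "0 \<le> x $ i \<and> x $ i \<le> 1" for i
    by (metis order_refl zero_le_one)
  then show "x \<in> unit_cube"
    by (simp add: unit_cube_def)
qed

lemma cube_vertices_eq_image: "(cube_vertices :: (real ^ 'n) set) = vec_lambda ` (PiE UNIV (\<lambda>_. {0, 1}))"
proof
  show "(cube_vertices :: (real ^ 'n) set) \<subseteq> vec_lambda ` (PiE UNIV (\<lambda>_. {0, 1}))"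
  proof
    fix x :: "real ^ 'n"
    assume "x \<in> cube_vertices"
    then have "vec_nth x \<in> PiE UNIV (\<lambda>_. {0, 1})"
      by (auto simp: cube_vertices_def)
    then have "vec_lambda (vec_nth x) \<in> vec_lambda ` (PiE UNIV (\<lambda>_. {0, 1 :: real}))"
      by (rule imageI)
    then show "x \<in> vec_lambda ` (PiE UNIV (\<lambda>_. {0, 1}))"
      by (simp add: vec_nth_inverse)
  qed
qed (auto simp: cube_vertices_def PiE_iff)

lemma finite_cube_vertices: "finite (cube_vertices :: (real ^ 'n) set)"
  unfolding cube_vertices_eq_image by (intro finite_imageI finite_PiE) auto

text \<open>
  Expanding the product over the coordinates: this normalises every product measure below.
\<close>

lemma sum_cube_vertices_prod:
  fixes \<phi> :: "'n::finite \<Rightarrow> real \<Rightarrow> real"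
  shows "(\<Sum>x\<in>cube_vertices. \<Prod>i\<in>UNIV. \<phi> i (x $ i)) = (\<Prod>i\<in>UNIV. \<phi> i 0 + \<phi> i 1)"
proof -
  have "inj_on vec_lambda (PiE (UNIV :: 'n set) (\<lambda>_. {0, 1 :: real}))"
    by (auto simp: inj_on_def vec_lambda_inject)
  then have "(\<Sum>x\<in>cube_vertices. \<Prod>i\<in>UNIV. \<phi> i (x $ i))
      = (\<Sum>u\<in>PiE UNIV (\<lambda>_. {0, 1}). \<Prod>i\<in>UNIV. \<phi> i (u i))"
    unfolding cube_vertices_eq_image by (subst sum.reindex) (auto simp: o_def)
  also have "\<dots> = (\<Prod>i\<in>UNIV. \<Sum>r\<in>{0, 1}. \<phi> i r)"
    by (subst prod_sum_PiE) auto
  finally show ?thesis by simp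
qed

lemma set_coord_vertex: "x \<in> cube_vertices \<Longrightarrow> s \<in> {0, 1} \<Longrightarrow> set_coord x i s \<in> cube_vertices"
  by (auto simp: cube_vertices_def)

lemma set_coord_self [simp]: "set_coord x i (x $ i) = x"
  by (simp add: vec_eq_iff)

lemma vertex_cases:
  assumes "x \<in> cube_vertices"
  obtains "set_coord x i 0 = x" "x $ i = 0" | "set_coord x i 1 = x" "x $ i = 1"
proof -
  have "x $ i = 0 \<or> x $ i = 1"
    using assms by (simp add: cube_vertices_def)
  then show ?thesis
    using that set_coord_self[of x i] by metis
qed

text \<open>
  Flipping coordinate \<open>i\<close> permutes the vertices, and a vertex together with its flip is the
  pair of vertices obtained by setting the coordinate to 0 and to 1.
\<close>

lemma sum_vertices_coord:
  fixes F :: "real ^ 'n \<Rightarrow> real"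
  shows "(\<Sum>x\<in>cube_vertices. F x) = (\<Sum>x\<in>cube_vertices. F (set_coord x i 0) + F (set_coord x i 1)) / 2"
proof -
  let ?flip = "\<lambda>x :: real ^ 'n. set_coord x i (1 - x $ i)"
  have "?flip x \<in> cube_vertices" if "x \<in> cube_vertices" for x
    using that by (intro set_coord_vertex) (auto elim: vertex_cases[of _ i])
  then have "(\<Sum>x\<in>cube_vertices. F x) = (\<Sum>x\<in>cube_vertices. F (?flip x))"
    by (intro sum.reindex_bij_witness[of _ ?flip ?flip]) simp_all
  then have "2 * (\<Sum>x\<in>cube_vertices. F x) = (\<Sum>x\<in>cube_vertices. F x + F (?flip x))"
    by (simp add: sum.distrib)
  also have "\<dots> = (\<Sum>x\<in>cube_vertices. F (set_coord x i 0) + F (set_coord x i 1))"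
    by (rule sum.cong) (auto elim: vertex_cases[of _ i])
  finally show ?thesis by simp
qed

text \<open>
  The balance condition says that, under the weights \<open>w\<close>, \<open>\<theta> x\<close> is the conditional
  probability that coordinate \<open>i\<close> is 1 given the others; the conclusion is then the tower
  property.  It serves both the Gibbs measure and the Bernoulli product measures.
\<close>

lemma sum_resample_coord:
  fixes w \<theta> F :: "real ^ 'n \<Rightarrow> real"
  assumes balance: "\<And>x. x \<in> cube_vertices \<Longrightarrow>
      w (set_coord x i 1) * (1 - \<theta> x) = w (set_coord x i 0) * \<theta> x"
    and \<theta>: "\<And>x s. \<theta> (set_coord x i s) = \<theta> x"
  shows "(\<Sum>x\<in>cube_vertices. w x * F x) =
         (\<Sum>x\<in>cube_vertices. w x * (\<theta> x * F (set_coord x i 1) + (1 - \<theta> x) * F (set_coord x i 0)))"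
proof -
  have "w (set_coord x i 0) * F (set_coord x i 0) + w (set_coord x i 1) * F (set_coord x i 1)
      = w (set_coord x i 0) * (\<theta> x * F (set_coord x i 1) + (1 - \<theta> x) * F (set_coord x i 0))
      + w (set_coord x i 1) * (\<theta> x * F (set_coord x i 1) + (1 - \<theta> x) * F (set_coord x i 0))"
    if "x \<in> cube_vertices" for x
    using balance[OF that] by algebra
  then show ?thesis
    by (subst (1 2) sum_vertices_coord[of _ i]) (simp add: \<theta>)
qed

section \<open>The logistic function\<close>

definition softplus :: "real \<Rightarrow> real" where
  "softplus u = ln (1 + exp u)"

definition sigmoid :: "real \<Rightarrow> real" where
  "sigmoid u = exp u / (1 + exp u)"

lemma sigmoid_bounds: "0 < sigmoid u" "sigmoid u < 1"
  by (simp_all add: sigmoid_def add_pos_pos divide_less_eq)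

lemma ln_sigmoid: "ln (sigmoid u) = u - softplus u" "ln (1 - sigmoid u) = - softplus u"
proof -
  have pos: "0 < 1 + exp u" by (simp add: add_pos_pos)
  then show "ln (sigmoid u) = u - softplus u"
    by (simp add: sigmoid_def softplus_def ln_div)
  have "1 - sigmoid u = inverse (1 + exp u)"
    using pos by (simp add: sigmoid_def field_simps)
  then show "ln (1 - sigmoid u) = - softplus u"
    using pos by (simp add: softplus_def ln_inverse)
qed

text \<open>
  With \<open>v\<close> and \<open>v + u\<close> the values of \<open>g\<close> at the two vertices that differ in one coordinate,
  this is the balance condition of \<open>sum_resample_coord\<close> for the Gibbs weights.
\<close>

lemma sigmoid_balance: "exp (v + u) * (1 - sigmoid u) = exp v * sigmoid u"
proof -
  have "1 + exp u \<noteq> 0" using exp_gt_zero[of u] by linarith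
  then show ?thesis by (simp add: sigmoid_def exp_add field_simps)
qed

lemma softplus_diff_le: "softplus u - softplus v \<le> \<bar>u - v\<bar>"
proof -
  have "exp u \<le> exp \<bar>u - v\<bar> * exp v"
    by (simp flip: exp_add)
  then have "1 + exp u \<le> exp \<bar>u - v\<bar> * 1 + exp \<bar>u - v\<bar> * exp v"
    by (intro add_mono) simp_all
  then have "1 + exp u \<le> exp \<bar>u - v\<bar> * (1 + exp v)"
    by (simp only: distrib_left)
  then have "ln (1 + exp u) \<le> ln (exp \<bar>u - v\<bar> * (1 + exp v))"
    by (subst ln_le_cancel_iff) (simp_all add: add_pos_pos)
  also have "\<dots> = \<bar>u - v\<bar> + ln (1 + exp v)"
    by (subst ln_mult_pos) (simp_all add: add_pos_pos)
  finally show ?thesis by (simp add: softplus_def)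
qed

lemma softplus_minus: "softplus (- u) = softplus u - u"
proof -
  have "1 + exp (- u) = (1 + exp u) * exp (- u)"
    by (simp add: distrib_right flip: exp_add)
  moreover have "0 < 1 + exp u" by (simp add: add_pos_pos)
  ultimately have "ln (1 + exp (- u)) = ln (1 + exp u) + ln (exp (- u))"
    by (simp only: ln_mult_pos exp_gt_zero)
  then show ?thesis by (simp add: softplus_def)
qed

text \<open>
  The left-hand side is the change of the negative log-likelihood of the outcome \<open>x\<close> when the
  logit moves from \<open>v\<close> to \<open>u\<close>.  For \<open>x = 1\<close> it is \<open>softplus (- u) - softplus (- v)\<close>, so in both
  cases it is an increment of the 1-Lipschitz function \<open>softplus\<close>.
\<close>

lemma softplus_bregman_le:
  assumes "x = 0 \<or> x = 1"
  shows "softplus u - softplus v - x * (u - v) \<le> \<bar>u - v\<bar>"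
  using assms softplus_diff_le[of u v] softplus_diff_le[of "- u" "- v"]
  by (auto simp: softplus_minus abs_minus_commute)

lemma sigmoid_deriv: "(sigmoid has_real_derivative sigmoid u * (1 - sigmoid u)) (at u)"
proof -
  have "1 + exp u \<noteq> 0" using exp_gt_zero[of u] by linarith
  then show ?thesis unfolding sigmoid_def
    by (auto intro!: derivative_eq_intros simp: field_simps power2_eq_square)
qed

lemma bernoulli_variance_le: "p * (1 - p) \<le> (1 / 4 :: real)"
proof -
  have "0 \<le> (p - 1 / 2)\<^sup>2" by simp
  then show ?thesis by (simp add: power2_eq_square algebra_simps)
qed

lemma sigmoid_lipschitz: "\<bar>sigmoid u - sigmoid v\<bar> \<le> 1 / 4 * \<bar>u - v\<bar>"
proof -
  have "norm (sigmoid u - sigmoid v) \<le> 1 / 4 * norm (u - v)"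
  proof (rule field_differentiable_bound[of UNIV sigmoid "\<lambda>u. sigmoid u * (1 - sigmoid u)"])
    fix z :: real
    show "norm (sigmoid z * (1 - sigmoid z)) \<le> 1 / 4"
      using sigmoid_bounds[of z] bernoulli_variance_le[of "sigmoid z"] by (simp add: abs_mult)
  qed (auto intro: sigmoid_deriv)
  then show ?thesis by simp
qed

section \<open>The mean-field upper bound\<close>

text \<open>
  The product measure in exponential form: coordinate \<open>i\<close> has logit \<open>d $ i\<close>, that is, mean
  \<open>sigmoid (d $ i)\<close>.
\<close>

definition product_weight :: "real ^ 'n \<Rightarrow> real ^ 'n \<Rightarrow> real" where
  "product_weight d x = exp (\<Sum>i\<in>UNIV. x $ i * d $ i - softplus (d $ i))"

lemma product_weight_pos: "0 < product_weight d x"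
  by (simp add: product_weight_def)

lemma sum_product_weight: "(\<Sum>x\<in>cube_vertices. product_weight d x) = 1"
proof -
  have "exp (- softplus u) + exp (u - softplus u) = 1" for u
  proof -
    have "0 < 1 + exp u" by (simp add: add_pos_pos)
    then show ?thesis
      by (simp add: softplus_def exp_minus exp_diff field_simps)
  qed
  then show ?thesis
    using sum_cube_vertices_prod[of "\<lambda>i r. exp (r * d $ i - softplus (d $ i))"]
    by (simp add: product_weight_def exp_sum)
qed

text \<open>
  Under the Gibbs weights \<open>w\<close>, the ratio \<open>q (net x) x / w x\<close> has mean at most \<open>card D\<close>, because
  bounding the chosen law by the sum of all of them loses a factor of at most \<open>card D\<close>.  The
  concavity of \<open>ln\<close>, used in the form \<open>ln r \<le> r - 1\<close>, then bounds the mean of the logarithm of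
  this ratio, and \<open>ln (w x) = g x - ln Z\<close>.
\<close>

lemma gibbs_coding_bound:
  fixes g :: "'a \<Rightarrow> real"
  assumes V: "finite V" "V \<noteq> {}" and D: "finite D" "D \<noteq> {}"
    and q: "\<And>d x. d \<in> D \<Longrightarrow> x \<in> V \<Longrightarrow> 0 < q d x" "\<And>d. d \<in> D \<Longrightarrow> (\<Sum>x\<in>V. q d x) = 1"
    and net: "\<And>x. x \<in> V \<Longrightarrow> net x \<in> D"
    and w: "\<And>x. w x = exp (g x) / (\<Sum>x\<in>V. exp (g x))"
  shows "ln (\<Sum>x\<in>V. exp (g x)) \<le> ln (card D) + (\<Sum>x\<in>V. w x * (g x - ln (q (net x) x)))"
proof -
  define Z where "Z = (\<Sum>x\<in>V. exp (g x))"
  have Z: "Z > 0" unfolding Z_def using V by (intro sum_pos) auto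
  have w_pos: "w x > 0" for x using Z by (simp add: w flip: Z_def)
  have w_sum: "(\<Sum>x\<in>V. w x) = 1"
    using Z by (simp add: w flip: Z_def sum_divide_distrib)
  have card: "real (card D) > 0" using D by (simp add: card_gt_0_iff)
  have "(\<Sum>x\<in>V. q (net x) x) \<le> (\<Sum>x\<in>V. \<Sum>d\<in>D. q d x)"
    using D q(1) net by (intro sum_mono member_le_sum) (auto intro: less_imp_le)
  also have "\<dots> = (\<Sum>d\<in>D. \<Sum>x\<in>V. q d x)" by (rule sum.swap)
  also have "\<dots> = card D" by (simp add: q(2))
  finally have total: "(\<Sum>x\<in>V. q (net x) x) \<le> card D" .
  have ptw: "w x * (ln (q (net x) x) - g x + ln Z - ln (card D)) \<le> q (net x) x / card D - w x"
    if x: "x \<in> V" for x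
  proof -
    have qp: "q (net x) x > 0" using q(1) net x by blast
    have "ln (q (net x) x) - g x + ln Z - ln (card D) = ln (q (net x) x / (w x * card D))"
      using qp w_pos[of x] card Z by (simp add: ln_div ln_mult w flip: Z_def)
    also have "\<dots> \<le> q (net x) x / (w x * card D) - 1"
      using qp w_pos[of x] card by (intro ln_le_minus_one) simp
    finally have "w x * (ln (q (net x) x) - g x + ln Z - ln (card D))
        \<le> w x * (q (net x) x / (w x * card D) - 1)"
      using w_pos[of x] by (intro mult_left_mono) auto
    also have "\<dots> = q (net x) x / card D - w x"
      using w_pos[of x] card by (simp add: field_simps)
    finally show ?thesis .
  qed
  have "(\<Sum>x\<in>V. w x * (ln (q (net x) x) - g x + ln Z - ln (card D)))
      \<le> (\<Sum>x\<in>V. q (net x) x / card D - w x)"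
    by (intro sum_mono ptw)
  also have "\<dots> = (\<Sum>x\<in>V. q (net x) x) / card D - 1"
    by (simp add: sum_subtractf w_sum sum_divide_distrib)
  also have "\<dots> \<le> 0" using total card by (simp add: divide_le_eq)
  finally have "(\<Sum>x\<in>V. (ln Z - ln (card D)) * w x - w x * (g x - ln (q (net x) x))) \<le> 0"
    by (simp add: algebra_simps)
  then show ?thesis
    by (simp add: sum_subtractf w_sum Z_def flip: sum_distrib_left)
qed

text \<open>
  The unconstrained bound.  The error consists of the price \<open>ln (card D) + \<eta>\<close> of the net, the
  cost of replacing the differences \<open>\<Delta> i\<close> by derivatives, which adds to the trace of \<open>N\<close>, and
  the cost of replacing \<open>X\<close> by the vector \<open>\<mu> X\<close> of conditional means.
\<close>

theorem mean_field_upper_bound: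
  fixes g :: "real ^ 'n \<Rightarrow> real" and N :: "'n \<Rightarrow> 'n \<Rightarrow> real"
  assumes grad: "has_gradient g G"
    and bound: "\<And>x. x \<in> unit_cube \<Longrightarrow> \<bar>g x\<bar> \<le> l"
    and lip: "\<And>i. lipschitz_on_cube (\<lambda>j. N j i) (G i)"
    and M: "\<And>x. x \<in> unit_cube \<Longrightarrow> g x - entropy_I x \<le> M"
    and D: "finite D"
    and net: "\<And>x. x \<in> cube_vertices \<Longrightarrow> \<exists>d\<in>D. (\<Sum>i\<in>UNIV. \<bar>G i x - d $ i\<bar>) \<le> \<eta>"
  shows "ln (\<Sum>x\<in>cube_vertices. exp (g x))
    \<le> M + ln (card D) + \<eta> + 5 / 4 * (\<Sum>i\<in>UNIV. N i i)
      + sqrt (l / 8 * (\<Sum>i\<in>UNIV. \<Sum>j\<in>UNIV. (N i j)\<^sup>2))"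
proof -
  let ?V = "cube_vertices :: (real ^ 'n) set"
  define Z where "Z = (\<Sum>x\<in>?V. exp (g x))"
  define w where "w x = exp (g x) / Z" for x
  define \<Delta> where "\<Delta> i x = g (set_coord x i 1) - g (set_coord x i 0)" for i x
  define p where "p i x = sigmoid (\<Delta> i x)" for i x
  define \<mu> where "\<mu> x = (\<chi> i. p i x)" for x
  note V_fin = finite_cube_vertices[where 'n = 'n]
  have V_ne: "?V \<noteq> {}"
  proof -
    have "(0 :: real ^ 'n) \<in> ?V" by (simp add: cube_vertices_def)
    then show ?thesis by blast
  qed
  have V_cube: "x \<in> unit_cube" if "x \<in> ?V" for x
    using that cube_vertices_subset by blast
  have Z: "Z > 0"
    unfolding Z_def using V_fin V_ne by (intro sum_pos) auto
  have w_nonneg: "0 \<le> w x" for x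
    using Z by (simp add: w_def)
  have w_sum: "(\<Sum>x\<in>?V. w x) = 1"
    using Z by (simp add: w_def Z_def flip: sum_divide_distrib)
  have avg_le: "(\<Sum>x\<in>?V. w x * F x) \<le> C" if "\<And>x. x \<in> ?V \<Longrightarrow> F x \<le> C" for F C
  proof -
    have "(\<Sum>x\<in>?V. w x * F x) \<le> (\<Sum>x\<in>?V. w x * C)"
      using that w_nonneg by (intro sum_mono mult_left_mono) auto
    also have "\<dots> = C" by (simp add: w_sum flip: sum_distrib_right)
    finally show ?thesis .
  qed
  have p_bounds: "0 < p i x" "p i x < 1" for i x
    by (simp_all add: p_def sigmoid_bounds)
  have \<mu>_cube: "\<mu> x \<in> unit_cube" for x
    using p_bounds by (auto simp: \<mu>_def unit_cube_def intro: less_imp_le)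
  have p_set_coord [simp]: "p i (set_coord x i s) = p i x" for i x s
    by (simp add: p_def \<Delta>_def)
  have N_nonneg: "0 \<le> N j i" for i j
  proof -
    have "\<bar>G i (set_coord 0 j 1) - G i (set_coord 0 j 0)\<bar> \<le> N j i * \<bar>1 - 0\<bar>"
      using lipschitz_coord[OF lip zero_in_unit_cube, of 0 1 i j] by simp
    then show ?thesis by simp
  qed

  \<comment> \<open>\<open>X i - p i X\<close> has conditional mean zero, so only the variation of \<open>F\<close>
    in coordinate \<open>i\<close> contributes, weighted by the conditional variance.\<close>
  have centered: "(\<Sum>x\<in>?V. w x * ((x $ i - p i x) * F x))
      = (\<Sum>x\<in>?V. w x * (p i x * (1 - p i x) * (F (set_coord x i 1) - F (set_coord x i 0))))"
    for i F
  proof -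
    have bal: "w (set_coord x i 1) * (1 - p i x) = w (set_coord x i 0) * p i x" for x
      using sigmoid_balance[of "g (set_coord x i 0)" "\<Delta> i x"]
      by (simp add: w_def p_def \<Delta>_def)
    show ?thesis
      by (subst sum_resample_coord[where w = w and \<theta> = "p i" and i = i], rule bal, simp)
         (simp add: algebra_simps)
  qed

  define S where "S = (\<Sum>i\<in>UNIV. N i i)"
  define Q where "Q = (\<Sum>i\<in>UNIV. \<Sum>j\<in>UNIV. (N i j)\<^sup>2)"
  have S: "0 \<le> S" unfolding S_def by (intro sum_nonneg N_nonneg)
  have Q: "0 \<le> Q" unfolding Q_def by (intro sum_nonneg) simp

  \<comment> \<open>First-order interpolation between \<open>\<mu> X\<close> and \<open>X\<close>.\<close>
  have drift: "(\<Sum>x\<in>?V. w x * (g x - g (\<mu> x))) \<le> S / 4 + Q / 16"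
  proof -
    let ?z = "\<lambda>t x. \<mu> x + t *\<^sub>R (x - \<mu> x)"
    have z_cube: "?z t x \<in> unit_cube" if "x \<in> ?V" "t \<in> {0..1}" for t x
      using that V_cube \<mu>_cube by (intro line_in_unit_cube) auto
    have "((\<lambda>t. \<Sum>x\<in>?V. w x * g (?z t x)) has_real_derivative
        (\<Sum>x\<in>?V. w x * (\<Sum>i\<in>UNIV. G i (?z t x) * (x $ i - \<mu> x $ i)))) (at t within {0..1})"
      if "t \<in> {0..1}" for t
      using that by (intro DERIV_sum DERIV_cmult has_gradient_on_line grad \<mu>_cube V_cube)
    from mean_value_unit_interval[OF this] obtain t where t: "t \<in> {0..1}"
      and "(\<Sum>x\<in>?V. w x * g (?z 1 x)) - (\<Sum>x\<in>?V. w x * g (?z 0 x))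
         = (\<Sum>x\<in>?V. w x * (\<Sum>i\<in>UNIV. G i (?z t x) * (x $ i - \<mu> x $ i)))"
      by blast
    then have "(\<Sum>x\<in>?V. w x * (g x - g (\<mu> x)))
        = (\<Sum>x\<in>?V. \<Sum>i\<in>UNIV. w x * ((x $ i - p i x) * G i (?z t x)))"
      by (simp add: right_diff_distrib sum_subtractf \<mu>_def sum_distrib_left mult_ac)
    also have "\<dots> = (\<Sum>i\<in>UNIV. \<Sum>x\<in>?V. w x * ((x $ i - p i x) * G i (?z t x)))"
      by (rule sum.swap)
    also have "\<dots> = (\<Sum>i\<in>UNIV. \<Sum>x\<in>?V. w x * (p i x * (1 - p i x) *
        (G i (?z t (set_coord x i 1)) - G i (?z t (set_coord x i 0)))))"
      by (simp only: centered)
    also have "\<dots> \<le> (\<Sum>i\<in>UNIV. 1 / 4 * (N i i + (\<Sum>j\<in>UNIV. 1 / 4 * (N j i)\<^sup>2)))"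
    proof (intro sum_mono avg_le)
      fix i and x :: "real ^ 'n"
      assume x: "x \<in> ?V"
      let ?x1 = "set_coord x i 1" and ?x0 = "set_coord x i 0"
      have x01: "?x1 \<in> ?V" "?x0 \<in> ?V" using x by (auto intro: set_coord_vertex)
      \<comment> \<open>Changing coordinate \<open>i\<close> of \<open>x\<close> moves coordinate \<open>i\<close>
        of the interpolation point by at most 1, and moves the others only through the conditional means.\<close>
      have step: "N j i * \<bar>?z t ?x1 $ j - ?z t ?x0 $ j\<bar> \<le> (if j = i then N i i else 0) + 1 / 4 * (N j i)\<^sup>2"
        for j
      proof (cases "j = i")
        case True
        then have "N j i * \<bar>?z t ?x1 $ j - ?z t ?x0 $ j\<bar> = N i i * t"
          using t by (simp add: \<mu>_def algebra_simps)
        also have "\<dots> \<le> N i i"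
          using t N_nonneg by (intro mult_right_le_one_le) auto
        also have "\<dots> \<le> N i i + 1 / 4 * (N j i)\<^sup>2" by simp
        finally show ?thesis using True by simp
      next
        case False
        have "\<bar>\<Delta> j ?x1 - \<Delta> j ?x0\<bar> \<le> N j i"
          using second_difference_bound[OF grad lip V_cube[OF x] False[symmetric]]
          by (simp add: \<Delta>_def)
        then have "\<bar>p j ?x1 - p j ?x0\<bar> \<le> 1 / 4 * N j i"
          using sigmoid_lipschitz[of "\<Delta> j ?x1" "\<Delta> j ?x0"] by (simp add: p_def)
        moreover have "\<bar>?z t ?x1 $ j - ?z t ?x0 $ j\<bar> = \<bar>(1 - t) * (p j ?x1 - p j ?x0)\<bar>"
          using False by (simp add: \<mu>_def algebra_simps)
        moreover have "\<bar>(1 - t) * (p j ?x1 - p j ?x0)\<bar> \<le> \<bar>p j ?x1 - p j ?x0\<bar>"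
          unfolding abs_mult using t by (intro mult_left_le_one_le) auto
        ultimately have "\<bar>?z t ?x1 $ j - ?z t ?x0 $ j\<bar> \<le> 1 / 4 * N j i"
          by linarith
        then have "N j i * \<bar>?z t ?x1 $ j - ?z t ?x0 $ j\<bar> \<le> N j i * (1 / 4 * N j i)"
          by (intro mult_left_mono N_nonneg)
        then show ?thesis
          using False by (simp add: power2_eq_square)
      qed
      have "G i (?z t ?x1) - G i (?z t ?x0) \<le> (\<Sum>j\<in>UNIV. N j i * \<bar>?z t ?x1 $ j - ?z t ?x0 $ j\<bar>)"
        using lipschitz_on_cubeD[OF lip z_cube[OF x01(2) t] z_cube[OF x01(1) t], of i] by linarith
      also have "\<dots> \<le> (\<Sum>j\<in>UNIV. (if j = i then N i i else 0) + 1 / 4 * (N j i)\<^sup>2)"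
        by (intro sum_mono step)
      also have "\<dots> = N i i + (\<Sum>j\<in>UNIV. 1 / 4 * (N j i)\<^sup>2)"
        by (simp add: sum.distrib)
      finally have diff: "G i (?z t ?x1) - G i (?z t ?x0) \<le> N i i + (\<Sum>j\<in>UNIV. 1 / 4 * (N j i)\<^sup>2)" .
      have pp: "0 \<le> p i x * (1 - p i x)" using p_bounds[of i x] by simp
      have "p i x * (1 - p i x) * (G i (?z t ?x1) - G i (?z t ?x0))
          \<le> p i x * (1 - p i x) * (N i i + (\<Sum>j\<in>UNIV. 1 / 4 * (N j i)\<^sup>2))"
        by (intro mult_left_mono diff pp)
      also have "\<dots> \<le> 1 / 4 * (N i i + (\<Sum>j\<in>UNIV. 1 / 4 * (N j i)\<^sup>2))"
        by (intro mult_right_mono bernoulli_variance_le add_nonneg_nonneg sum_nonneg N_nonneg) simp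
      finally show "p i x * (1 - p i x) * (G i (?z t ?x1) - G i (?z t ?x0))
          \<le> 1 / 4 * (N i i + (\<Sum>j\<in>UNIV. 1 / 4 * (N j i)\<^sup>2))" .
    qed
    also have "\<dots> = S / 4 + Q / 16"
    proof -
      have "(\<Sum>i\<in>UNIV. \<Sum>j\<in>UNIV. (N j i)\<^sup>2) = Q" unfolding Q_def by (rule sum.swap)
      then show ?thesis
        by (simp add: S_def sum.distrib distrib_left flip: sum_distrib_left sum_divide_distrib)
    qed
    finally show ?thesis .
  qed
  have trivial: "(\<Sum>x\<in>?V. w x * (g x - g (\<mu> x))) \<le> 2 * l"
  proof (rule avg_le)
    fix x assume "x \<in> ?V"
    then show "g x - g (\<mu> x) \<le> 2 * l"
      using bound[OF V_cube, of x] bound[OF \<mu>_cube, of x] by linarith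
  qed
  have l: "0 \<le> l"
    using bound[OF zero_in_unit_cube] by linarith
  \<comment> \<open>The smaller of \<open>Q / 16\<close> and \<open>2 * l\<close> is at most their geometric
    mean.\<close>
  have energy: "(\<Sum>x\<in>?V. w x * (g x - g (\<mu> x))) \<le> S / 4 + sqrt (l / 8 * Q)"
  proof (cases "Q / 16 \<le> 2 * l")
    case True
    then have "(Q / 16)\<^sup>2 \<le> Q / 16 * (2 * l)"
      using Q unfolding power2_eq_square by (intro mult_left_mono) auto
    then have "Q / 16 \<le> sqrt (l / 8 * Q)"
      by (intro real_le_rsqrt) (simp add: mult.commute)
    then show ?thesis using drift by linarith
  next
    case False
    then have "(2 * l)\<^sup>2 \<le> Q / 16 * (2 * l)"
      using l unfolding power2_eq_square by (intro mult_right_mono) auto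
    then have "2 * l \<le> sqrt (l / 8 * Q)"
      by (intro real_le_rsqrt) (simp add: mult.commute)
    then show ?thesis using trivial S by linarith
  qed

  from net obtain d where d: "\<And>x. x \<in> ?V \<Longrightarrow> d x \<in> D"
    "\<And>x. x \<in> ?V \<Longrightarrow> (\<Sum>i\<in>UNIV. \<bar>G i x - d x $ i\<bar>) \<le> \<eta>"
    by metis
  have D_ne: "D \<noteq> {}" using d(1) V_ne by blast

  \<comment> \<open>Pointwise, the Bregman terms pay for the distance of the logits \<open>d x $ i\<close> and
    \<open>\<Delta> i x\<close>; the remaining linear term averages to zero.\<close>
  have coding: "g x - ln (product_weight (d x) x)
      \<le> (g x - g (\<mu> x)) + M + (\<eta> + S) - (\<Sum>i\<in>UNIV. (x $ i - p i x) * \<Delta> i x)"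
    if x: "x \<in> ?V" for x
  proof -
    have ent: "entropy_I (\<mu> x) = (\<Sum>i\<in>UNIV. p i x * \<Delta> i x - softplus (\<Delta> i x))"
      by (auto simp: entropy_I_def \<mu>_def p_def ln_sigmoid algebra_simps intro!: sum.cong)
    have "\<bar>\<Delta> i x - G i x\<bar> \<le> N i i" for i
    proof -
      obtain \<xi> where \<xi>: "\<xi> \<in> {0..1}" "\<Delta> i x = G i (set_coord x i \<xi>)"
        using mean_value_coord[OF grad V_cube[OF x], of 0 1 i] by (auto simp: \<Delta>_def)
      have xi: "x $ i \<in> {0..1}" using V_cube[OF x] by (simp add: unit_cube_def)
      have "\<bar>G i (set_coord x i \<xi>) - G i (set_coord x i (x $ i))\<bar> \<le> N i i * \<bar>\<xi> - x $ i\<bar>"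
        using lipschitz_coord[OF lip V_cube[OF x] xi \<xi>(1)] .
      also have "\<dots> \<le> N i i"
        using \<xi>(1) xi by (intro mult_right_le_one_le N_nonneg) auto
      finally show ?thesis using \<xi>(2) by simp
    qed
    then have tri: "\<bar>d x $ i - \<Delta> i x\<bar> \<le> \<bar>G i x - d x $ i\<bar> + N i i" for i
      by (smt (verit))
    have "entropy_I (\<mu> x) - ln (product_weight (d x) x) + (\<Sum>i\<in>UNIV. (x $ i - p i x) * \<Delta> i x)
        = (\<Sum>i\<in>UNIV. softplus (d x $ i) - softplus (\<Delta> i x) - x $ i * (d x $ i - \<Delta> i x))"
      by (simp add: ent product_weight_def sum_subtractf sum.distrib algebra_simps)
    also have "\<dots> \<le> (\<Sum>i\<in>UNIV. \<bar>G i x - d x $ i\<bar> + N i i)"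
    proof (rule sum_mono)
      fix i
      have "softplus (d x $ i) - softplus (\<Delta> i x) - x $ i * (d x $ i - \<Delta> i x) \<le> \<bar>d x $ i - \<Delta> i x\<bar>"
        using x by (intro softplus_bregman_le) (simp add: cube_vertices_def)
      then show "softplus (d x $ i) - softplus (\<Delta> i x) - x $ i * (d x $ i - \<Delta> i x)
          \<le> \<bar>G i x - d x $ i\<bar> + N i i"
        using tri[of i] by linarith
    qed
    also have "\<dots> \<le> \<eta> + S" using d(2)[OF x] by (simp add: sum.distrib S_def)
    finally show ?thesis using M[OF \<mu>_cube[of x]] by linarith
  qed

  have zero: "(\<Sum>x\<in>?V. w x * (\<Sum>i\<in>UNIV. (x $ i - p i x) * \<Delta> i x)) = 0"
  proof -
    have "(\<Sum>x\<in>?V. w x * (\<Sum>i\<in>UNIV. (x $ i - p i x) * \<Delta> i x))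
        = (\<Sum>i\<in>UNIV. \<Sum>x\<in>?V. w x * ((x $ i - p i x) * \<Delta> i x))"
      unfolding sum_distrib_left by (rule sum.swap)
    also have "\<dots> = 0" by (simp only: centered) (simp add: \<Delta>_def)
    finally show ?thesis .
  qed

  have "ln Z \<le> ln (card D) + (\<Sum>x\<in>?V. w x * (g x - ln (product_weight (d x) x)))"
    unfolding Z_def
    by (rule gibbs_coding_bound)
       (use V_fin V_ne D D_ne d(1) in \<open>auto simp: sum_product_weight product_weight_pos w_def Z_def\<close>)
  also have "(\<Sum>x\<in>?V. w x * (g x - ln (product_weight (d x) x)))
      \<le> (\<Sum>x\<in>?V. w x * ((g x - g (\<mu> x)) + M + (\<eta> + S) - (\<Sum>i\<in>UNIV. (x $ i - p i x) * \<Delta> i x)))"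
    by (intro sum_mono mult_left_mono coding w_nonneg)
  also have "\<dots> = (\<Sum>x\<in>?V. w x * (g x - g (\<mu> x))) + M + (\<eta> + S)"
    by (simp only: right_diff_distrib[of _ _ "sum _ _"] distrib_left sum_subtractf sum.distrib zero
          sum_distrib_right[symmetric] w_sum mult_1_left)
  finally show ?thesis
    using energy unfolding Z_def S_def Q_def by linarith
qed

section \<open>A smooth penalty for the constraint\<close>

text \<open>
  Squares of positive parts are the building blocks of the penalty because they are
  differentiable across their kink.
\<close>

lemma has_real_derivative_pos_part_sq:
  "((\<lambda>u. (max 0 u)\<^sup>2) has_real_derivative 2 * max 0 u) (at u)"
proof -
  consider "u < 0" | "u = 0" | "0 < u" by linarith
  then show ?thesis
  proof cases
    case 1
    have "((\<lambda>u :: real. 0) has_real_derivative 0) (at u)" by simp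
    then have "((\<lambda>u. (max 0 u)\<^sup>2) has_real_derivative 0) (at u)"
      by (rule has_field_derivative_transform_within_open[of _ _ _ "{..<0}"]) (use 1 in auto)
    then show ?thesis using 1 by simp
  next
    case 2
    have "((\<lambda>h :: real. max 0 h) \<longlongrightarrow> max 0 0) (at 0)"
      by (intro tendsto_intros)
    then have "((\<lambda>h :: real. max 0 h) \<longlongrightarrow> 0) (at 0)" by simp
    then have "((\<lambda>h :: real. (max 0 h)\<^sup>2 / h) \<longlongrightarrow> 0) (at 0)"
      by (rule Lim_transform_eventually)
         (auto simp: eventually_at_filter max_def power2_eq_square)
    then show ?thesis using 2 by (simp add: DERIV_def)
  next
    case 3
    have "((\<lambda>u :: real. u\<^sup>2) has_real_derivative 2 * u) (at u)"
      by (auto intro!: derivative_eq_intros)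
    then have "((\<lambda>u. (max 0 u)\<^sup>2) has_real_derivative 2 * u) (at u)"
      by (rule has_field_derivative_transform_within_open[of _ _ _ "{0<..}"]) (use 3 in auto)
    then show ?thesis using 3 by simp
  qed
qed

text \<open>
  A monotone transition from 0 to 1 on the unit interval.  Its derivative is the tent of height
  2 and slope 4 over that interval, the transition whose derivative has the least possible
  Lipschitz constant.
\<close>

definition ramp :: "real \<Rightarrow> real" where
  "ramp u = 2 * ((max 0 u)\<^sup>2 - 2 * (max 0 (u - 1 / 2))\<^sup>2 + (max 0 (u - 1))\<^sup>2)"

definition ramp_slope :: "real \<Rightarrow> real" where
  "ramp_slope u = 4 * (max 0 u - 2 * max 0 (u - 1 / 2) + max 0 (u - 1))"

lemma ramp_deriv: "(ramp has_real_derivative ramp_slope u) (at u)"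
proof -
  have shift: "((\<lambda>u. (max 0 (u - c))\<^sup>2) has_real_derivative 2 * max 0 (u - c)) (at u)" for c :: real
  proof -
    have "((\<lambda>u. u - c) has_real_derivative 1) (at u)"
      by (auto intro!: derivative_eq_intros)
    from DERIV_chain'[OF this has_real_derivative_pos_part_sq] show ?thesis by simp
  qed
  have "((\<lambda>u. 2 * ((max 0 u)\<^sup>2 - 2 * (max 0 (u - 1 / 2))\<^sup>2 + (max 0 (u - 1))\<^sup>2)) has_real_derivative
      2 * (2 * max 0 u - 2 * (2 * max 0 (u - 1 / 2)) + 2 * max 0 (u - 1))) (at u)"
    by (intro DERIV_cmult DERIV_add DERIV_diff shift has_real_derivative_pos_part_sq)
  then show ?thesis
    by (simp add: ramp_def[abs_def] ramp_slope_def)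
qed

lemma ramp_eq_0: "u \<le> 0 \<Longrightarrow> ramp u = 0"
  by (simp add: ramp_def max_def)

lemma ramp_eq_1: "1 \<le> u \<Longrightarrow> ramp u = 1"
  by (auto simp: ramp_def max_def power2_eq_square algebra_simps)

lemma ramp_slope_bounds: "0 \<le> ramp_slope u" "ramp_slope u \<le> 2"
  by (auto simp: ramp_slope_def max_def)

lemma ramp_slope_eq_0: "u \<le> 0 \<Longrightarrow> ramp_slope u = 0"
  by (simp add: ramp_slope_def max_def)

lemma ramp_slope_lipschitz: "\<bar>ramp_slope u - ramp_slope v\<bar> \<le> 4 * \<bar>u - v\<bar>"
  by (auto simp: ramp_slope_def max_def abs_if)

lemma ramp_mono: "u \<le> v \<Longrightarrow> ramp u \<le> ramp v"
  by (rule DERIV_nonneg_imp_nondecreasing) (auto intro: ramp_deriv ramp_slope_bounds)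

lemma ramp_bounds: "0 \<le> ramp u" "ramp u \<le> 1"
  using ramp_mono[of "min u 0" u] ramp_mono[of u "max u 1"]
  by (auto simp: ramp_eq_0 ramp_eq_1)

text \<open>
  Two ramps, one for each sign of \<open>y\<close>, instead of one ramp in \<open>\<bar>y\<bar>\<close>: this is differentiable
  everywhere, and for \<open>\<tau> > 0\<close> at most one of the ramps is active at any given point.
\<close>

definition penalty :: "real \<Rightarrow> real \<Rightarrow> real \<Rightarrow> real" where
  "penalty \<tau> \<kappa> y = ramp ((y - \<tau>) / \<kappa>) + ramp ((- y - \<tau>) / \<kappa>)"

definition penalty_deriv :: "real \<Rightarrow> real \<Rightarrow> real \<Rightarrow> real" where
  "penalty_deriv \<tau> \<kappa> y = (ramp_slope ((y - \<tau>) / \<kappa>) - ramp_slope ((- y - \<tau>) / \<kappa>)) / \<kappa>"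

context
  fixes \<tau> \<kappa> :: real
  assumes \<tau>: "0 < \<tau>" and \<kappa>: "0 < \<kappa>"
begin

lemma penalty_has_deriv: "(penalty \<tau> \<kappa> has_real_derivative penalty_deriv \<tau> \<kappa> y) (at y)"
proof -
  have "((\<lambda>y. (y - \<tau>) / \<kappa>) has_real_derivative 1 / \<kappa>) (at y)"
    "((\<lambda>y. (- y - \<tau>) / \<kappa>) has_real_derivative - 1 / \<kappa>) (at y)"
    using \<kappa> by (auto intro!: derivative_eq_intros)
  from this[THEN DERIV_chain'[OF _ ramp_deriv]]
  have "((\<lambda>y. ramp ((y - \<tau>) / \<kappa>) + ramp ((- y - \<tau>) / \<kappa>)) has_real_derivative
      ramp_slope ((y - \<tau>) / \<kappa>) * (1 / \<kappa>) + ramp_slope ((- y - \<tau>) / \<kappa>) * (- 1 / \<kappa>)) (at y)"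
    by (rule DERIV_add)
  then show ?thesis
    by (simp add: penalty_def[abs_def] penalty_deriv_def diff_divide_distrib)
qed

lemma penalty_eq_0:
  assumes "\<bar>y\<bar> \<le> \<tau>"
  shows "penalty \<tau> \<kappa> y = 0"
proof -
  have "(y - \<tau>) / \<kappa> \<le> 0" "(- y - \<tau>) / \<kappa> \<le> 0"
    using assms \<kappa> by (simp_all add: divide_le_0_iff)
  then show ?thesis by (simp add: penalty_def ramp_eq_0)
qed

lemma penalty_eq_1:
  assumes "\<tau> + \<kappa> \<le> \<bar>y\<bar>"
  shows "penalty \<tau> \<kappa> y = 1"
proof (cases "0 \<le> y")
  case True
  then have "1 \<le> (y - \<tau>) / \<kappa>" "(- y - \<tau>) / \<kappa> \<le> 0"
    using assms \<kappa> \<tau> by (simp_all add: divide_le_0_iff le_divide_eq)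
  then show ?thesis by (simp add: penalty_def ramp_eq_0 ramp_eq_1)
next
  case False
  then have "(y - \<tau>) / \<kappa> \<le> 0" "1 \<le> (- y - \<tau>) / \<kappa>"
    using assms \<kappa> \<tau> by (simp_all add: divide_le_0_iff le_divide_eq)
  then show ?thesis by (simp add: penalty_def ramp_eq_0 ramp_eq_1)
qed

lemma penalty_bounds: "0 \<le> penalty \<tau> \<kappa> y" "penalty \<tau> \<kappa> y \<le> 1"
proof -
  have "(y - \<tau>) / \<kappa> \<le> 0 \<or> (- y - \<tau>) / \<kappa> \<le> 0"
    using \<tau> \<kappa> by (simp add: divide_le_0_iff) linarith
  then show "penalty \<tau> \<kappa> y \<le> 1"
    using ramp_bounds by (auto simp: penalty_def ramp_eq_0)
qed (simp add: penalty_def ramp_bounds)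

lemma penalty_deriv_bound: "\<bar>penalty_deriv \<tau> \<kappa> y\<bar> \<le> 2 / \<kappa>"
proof -
  have "\<bar>ramp_slope ((y - \<tau>) / \<kappa>) - ramp_slope ((- y - \<tau>) / \<kappa>)\<bar> \<le> 2"
    using ramp_slope_bounds[of "(y - \<tau>) / \<kappa>"] ramp_slope_bounds[of "(- y - \<tau>) / \<kappa>"] by linarith
  then show ?thesis
    using \<kappa> by (simp add: penalty_deriv_def abs_divide divide_right_mono)
qed

lemma penalty_deriv_lipschitz: "\<bar>penalty_deriv \<tau> \<kappa> y - penalty_deriv \<tau> \<kappa> z\<bar> \<le> 4 / \<kappa>\<^sup>2 * \<bar>y - z\<bar>"
proof -
  let ?T = "\<lambda>y. ramp_slope ((y - \<tau>) / \<kappa>) - ramp_slope ((- y - \<tau>) / \<kappa>)"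
  have plus: "\<bar>ramp_slope ((y - \<tau>) / \<kappa>) - ramp_slope ((z - \<tau>) / \<kappa>)\<bar> \<le> 4 * \<bar>y - z\<bar> / \<kappa>" for y z
    using ramp_slope_lipschitz[of "(y - \<tau>) / \<kappa>" "(z - \<tau>) / \<kappa>"] \<kappa>
    by (simp add: abs_divide flip: diff_divide_distrib)
  have zero: "ramp_slope ((y - \<tau>) / \<kappa>) = 0" if "y \<le> \<tau>" for y
    using that \<kappa> by (intro ramp_slope_eq_0) (simp add: divide_le_0_iff)
  \<comment> \<open>On a half-line only one ramp is active; points of opposite sign are compared through 0, where
    the slope vanishes.\<close>
  have same: "\<bar>?T y - ?T z\<bar> \<le> 4 * \<bar>y - z\<bar> / \<kappa>" if "0 \<le> y \<and> 0 \<le> z \<or> y \<le> 0 \<and> z \<le> 0" for y z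
    using that
  proof
    assume "0 \<le> y \<and> 0 \<le> z"
    then show ?thesis using plus[of y z] \<tau> by (simp add: zero)
  next
    assume "y \<le> 0 \<and> z \<le> 0"
    then show ?thesis using plus[of "- y" "- z"] \<tau> by (simp add: zero abs_minus_commute)
  qed
  have T0: "?T 0 = 0" by simp
  have "\<bar>?T y - ?T z\<bar> \<le> 4 * \<bar>y - z\<bar> / \<kappa>"
  proof (cases "0 \<le> y \<and> 0 \<le> z \<or> y \<le> 0 \<and> z \<le> 0")
    case True
    then show ?thesis by (rule same)
  next
    case False
    have "\<bar>?T y - ?T z\<bar> \<le> \<bar>?T y - ?T 0\<bar> + \<bar>?T 0 - ?T z\<bar>" by linarith
    also have "\<dots> \<le> 4 * \<bar>y - 0\<bar> / \<kappa> + 4 * \<bar>0 - z\<bar> / \<kappa>"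
      by (intro add_mono same) auto
    also have "\<dots> = 4 * (\<bar>y\<bar> + \<bar>z\<bar>) / \<kappa>" by (simp add: add_divide_distrib)
    also have "\<bar>y\<bar> + \<bar>z\<bar> = \<bar>y - z\<bar>" using False by linarith
    finally show ?thesis .
  qed
  then have "\<bar>?T y - ?T z\<bar> / \<kappa> \<le> 4 * \<bar>y - z\<bar> / \<kappa> / \<kappa>"
    using \<kappa> by (intro divide_right_mono) auto
  then show ?thesis
    using \<kappa> by (simp add: penalty_deriv_def abs_divide power2_eq_square flip: diff_divide_distrib)
qed

end

section \<open>The constrained upper bound\<close>

text \<open>
  The midpoints of \<open>\<lceil>R * B / \<rho>\<rceil>\<close> equal subintervals.  When \<open>R * B / \<rho> \<le> 1\<close> one point
  suffices; otherwise rounding up at most doubles the number, which gives the factor 2.  The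
  weight \<open>B\<close> is kept as a factor so that the case \<open>B = 0\<close> is included.
\<close>

lemma interval_net:
  fixes R B \<rho> :: real
  assumes R: "0 < R" and B: "0 \<le> B" and \<rho>: "0 < \<rho>"
  shows "\<exists>\<Gamma>. finite \<Gamma> \<and> real (card \<Gamma>) \<le> max 1 (2 * R * B / \<rho>)
    \<and> (\<forall>\<mu>. \<bar>\<mu>\<bar> \<le> R \<longrightarrow> (\<exists>\<nu>\<in>\<Gamma>. \<bar>\<nu>\<bar> \<le> R \<and> \<bar>\<mu> - \<nu>\<bar> * B \<le> \<rho>))"
proof (cases "R * B \<le> \<rho>")
  case True
  have "\<bar>\<mu> - 0\<bar> * B \<le> \<rho>" if "\<bar>\<mu>\<bar> \<le> R" for \<mu>
    using mult_right_mono[OF that B] True by simp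
  then show ?thesis
    using R by (intro exI[of _ "{0}"]) auto
next
  case False
  define N where "N = nat \<lceil>R * B / \<rho>\<rceil>"
  have big: "1 < R * B / \<rho>" using False \<rho> by (simp add: less_divide_eq)
  have N_ge: "R * B / \<rho> \<le> real N" unfolding N_def by linarith
  have N_le: "real N \<le> R * B / \<rho> + 1" unfolding N_def using big by linarith
  have N_pos: "0 < real N" using N_ge big by linarith
  define \<nu> where "\<nu> k = - R + (2 * real k + 1) * R / real N" for k
  have "real (card (\<nu> ` {..<N})) \<le> real N"
    using card_image_le[of "{..<N}" \<nu>] by simp
  also have "\<dots> \<le> R * B / \<rho> + R * B / \<rho>"
    by (rule order_trans[OF N_le add_left_mono[OF less_imp_le[OF big]]])
  also have "\<dots> = 2 * R * B / \<rho>" by (simp add: field_simps)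
  also have "\<dots> \<le> max 1 (2 * R * B / \<rho>)" by (rule max.cobounded2)
  finally have card: "real (card (\<nu> ` {..<N})) \<le> max 1 (2 * R * B / \<rho>)" .
  have "\<exists>\<nu>\<in>\<nu> ` {..<N}. \<bar>\<nu>\<bar> \<le> R \<and> \<bar>\<mu> - \<nu>\<bar> * B \<le> \<rho>" if \<mu>: "\<bar>\<mu>\<bar> \<le> R" for \<mu>
  proof -
    define s where "s = (\<mu> + R) * real N / (2 * R)"
    have s0: "0 \<le> s" using \<mu> R N_pos unfolding s_def by (intro divide_nonneg_pos mult_nonneg_nonneg) auto
    have "(\<mu> + R) * real N \<le> (2 * R) * real N" using \<mu> N_pos by (intro mult_right_mono) auto
    then have sN: "s \<le> real N" using R by (simp add: s_def divide_le_eq mult.commute)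
    define k where "k = min (N - 1) (nat \<lfloor>s\<rfloor>)"
    have kN: "k < N" using N_pos unfolding k_def by auto
    have ks: "real k \<le> s" "s \<le> real k + 1"
    proof -
      show "real k \<le> s" using s0 unfolding k_def by linarith
      show "s \<le> real k + 1"
      proof (cases "nat \<lfloor>s\<rfloor> \<le> N - 1")
        case True
        then have "k = nat \<lfloor>s\<rfloor>" by (simp add: k_def)
        then show ?thesis using s0 by linarith
      next
        case False
        then have "k = N - 1" by (simp add: k_def)
        then show ?thesis using sN kN by auto
      qed
    qed
    have \<mu>_eq: "\<mu> = - R + 2 * s * R / real N"
      using R N_pos by (simp add: s_def field_simps)
    have "\<mu> - \<nu> k = (2 * (s - real k) - 1) * R / real N"
      unfolding \<nu>_def by (subst \<mu>_eq) (use N_pos in \<open>simp add: field_simps\<close>)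
    then have "\<bar>\<mu> - \<nu> k\<bar> = \<bar>2 * (s - real k) - 1\<bar> * (R / real N)"
      using R N_pos by (simp add: abs_mult)
    also have "\<dots> \<le> 1 * (R / real N)"
      using ks R N_pos by (intro mult_right_mono) auto
    finally have "\<bar>\<mu> - \<nu> k\<bar> * B \<le> R / real N * B"
      using B by (intro mult_right_mono) auto
    also have "\<dots> \<le> \<rho>"
      using N_ge N_pos \<rho> by (simp add: field_simps)
    finally have close: "\<bar>\<mu> - \<nu> k\<bar> * B \<le> \<rho>" .
    have "0 \<le> (2 * real k + 1) * R / real N" using R N_pos by simp
    moreover have "(2 * real k + 1) * R / real N \<le> 2 * R"
    proof -
      have "(2 * real k + 1) * R \<le> (2 * real N) * R"
        using kN R by (intro mult_right_mono) auto
      then show ?thesis using N_pos by (simp add: divide_le_eq mult_ac)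
    qed
    ultimately have "\<bar>\<nu> k\<bar> \<le> R" by (simp add: \<nu>_def abs_le_iff)
    with close kN show ?thesis by blast
  qed
  with card show ?thesis by (intro exI[of _ "\<nu> ` {..<N}"]) auto
qed

lemma C2_on_cubeD:
  fixes g :: "real ^ 'n \<Rightarrow> real"
  assumes "C2_on_cube g"
  shows "continuous_on unit_cube g"
    and "continuous_on unit_cube (partial i g)"
    and "continuous_on unit_cube (partial2 i j g)"
    and "has_gradient g (\<lambda>i. partial i g)"
    and "lipschitz_on_cube (\<lambda>i. sup_norm (partial2 i j g)) (partial j g)"
    and "lipschitz_on_cube (\<lambda>i. sup_norm (partial i g)) g"
proof -
  show "continuous_on unit_cube g"
    and c1: "\<And>i. continuous_on unit_cube (partial i g)"
    and c2: "\<And>i j. continuous_on unit_cube (partial2 i j g)"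
    and grad: "has_gradient g (\<lambda>i. partial i g)"
    using assms by (auto simp: C2_on_cube_def intro: differentiable_imp_continuous_on has_gradient_partial)
  have "has_gradient (partial j g) (\<lambda>i. partial2 i j g)"
    using assms unfolding partial2_def by (intro has_gradient_partial) (simp add: C2_on_cube_def)
  then show "lipschitz_on_cube (\<lambda>i. sup_norm (partial2 i j g)) (partial j g)"
    by (rule has_gradient_imp_lipschitz) (intro abs_le_sup_norm c2)
  show "lipschitz_on_cube (\<lambda>i. sup_norm (partial i g)) g"
    using grad by (rule has_gradient_imp_lipschitz) (intro abs_le_sup_norm c1)
qed

text \<open>
  Apply \<open>ln r \<le> r - 1\<close> with \<open>r = 1 / (2 * q)\<close> and with \<open>r = 1 / (2 * (1 - q))\<close>.
\<close>

lemma binary_entropy_ge: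
  fixes q :: real
  assumes "0 \<le> q" "q \<le> 1"
  shows "- ln 2 \<le> q * ln q + (1 - q) * ln (1 - q)"
proof (cases "q = 0 \<or> q = 1")
  case False
  with assms have q: "0 < q" "q < 1" by auto
  have key: "u - 1 / 2 \<le> u * (ln 2 + ln u)" if "0 < u" for u :: real
  proof -
    have "ln (1 / (2 * u)) \<le> 1 / (2 * u) - 1"
      using that by (intro ln_le_minus_one) simp
    then have "u * (1 - 1 / (2 * u)) \<le> u * (ln 2 + ln u)"
      using that by (intro mult_left_mono) (simp_all add: ln_div ln_mult)
    then show ?thesis using that by (simp add: right_diff_distrib)
  qed
  have "0 \<le> q * (ln 2 + ln q) + (1 - q) * (ln 2 + ln (1 - q))"
    using key[of q] key[of "1 - q"] q by linarith
  then show ?thesis by (simp add: algebra_simps)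
qed auto

text \<open>
  This decides the size of the penalty: the entropy can raise \<open>f - entropy_I\<close> by at most
  \<open>n * ln 2\<close>, and \<open>f\<close> itself varies by at most \<open>2 * a\<close>; the sum of the two is \<open>n * K\<close>.
\<close>

lemma entropy_I_ge:
  fixes x :: "real ^ 'n"
  assumes "x \<in> unit_cube"
  shows "- (real CARD('n) * ln 2) \<le> entropy_I x"
proof -
  have "(\<Sum>i\<in>(UNIV :: 'n set). - ln 2) \<le> entropy_I x"
    unfolding entropy_I_def using assms
    by (intro sum_mono binary_entropy_ge) (auto simp: unit_cube_def)
  then show ?thesis by simp
qed

lemma entropy_I_vertex:
  assumes "x \<in> cube_vertices"
  shows "entropy_I x = 0"
  unfolding entropy_I_def
proof (rule sum.neutral, rule ballI)
  fix i
  have "x $ i = 0 \<or> x $ i = 1" using assms by (simp add: cube_vertices_def)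
  then show "x $ i * ln (x $ i) + (1 - x $ i) * ln (1 - x $ i) = 0" by auto
qed

lemma sum_abs_le_l2:
  fixes u :: "'n::finite \<Rightarrow> real"
  shows "(\<Sum>i\<in>UNIV. \<bar>u i\<bar>) \<le> real CARD('n) * sqrt (1 / real CARD('n) * (\<Sum>i\<in>UNIV. (u i)\<^sup>2))"
proof -
  have "(\<Sum>i\<in>UNIV. \<bar>u i\<bar>)\<^sup>2 \<le> (\<Sum>i\<in>UNIV. (u i)\<^sup>2) * real CARD('n)"
    using sum_squared_le_sum_of_squares[of "\<lambda>i. \<bar>u i\<bar>" UNIV] by simp
  also have "\<dots> = (real CARD('n) * sqrt (1 / real CARD('n) * (\<Sum>i\<in>UNIV. (u i)\<^sup>2)))\<^sup>2"
    by (simp add: power_mult_distrib sum_nonneg power2_eq_square[of "real CARD('n)"])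
  finally show ?thesis
    by (rule power2_le_imp_le) (simp add: sum_nonneg)
qed

text \<open>
  The coding argument measures logits in the \<open>l1\<close> norm, so the Euclidean nets are used
  through the Cauchy-Schwarz inequality.
\<close>

lemma gradient_net_l1:
  fixes g :: "real ^ 'n \<Rightarrow> real"
  assumes "gradient_net g \<epsilon> D" "x \<in> unit_cube" "0 \<le> \<epsilon>"
  shows "\<exists>d\<in>D. (\<Sum>i\<in>UNIV. \<bar>partial i g x - d $ i\<bar>) \<le> real CARD('n) * \<epsilon>"
proof -
  obtain d where d: "d \<in> D" "(\<Sum>i\<in>UNIV. (partial i g x - d $ i)\<^sup>2) \<le> real CARD('n) * \<epsilon>\<^sup>2"
    using assms(1,2) unfolding gradient_net_def by blast
  have "sqrt (1 / real CARD('n) * (\<Sum>i\<in>UNIV. (partial i g x - d $ i)\<^sup>2)) \<le> \<epsilon>"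
    using d(2) assms(3) by (intro real_le_lsqrt) (auto simp: divide_le_eq mult.commute sum_nonneg)
  then have "real CARD('n) * sqrt (1 / real CARD('n) * (\<Sum>i\<in>UNIV. (partial i g x - d $ i)\<^sup>2))
      \<le> real CARD('n) * \<epsilon>"
    by (intro mult_left_mono) auto
  with d(1) sum_abs_le_l2[of "\<lambda>i. partial i g x - d $ i"] show ?thesis
    by (intro bexI[of _ d]) linarith+
qed

lemma gradient_net_card_pos:
  fixes g :: "real ^ 'n \<Rightarrow> real"
  assumes "gradient_net g \<epsilon> D"
  shows "0 < card D"
  using assms zero_in_unit_cube[where 'a = 'n] unfolding gradient_net_def card_gt_0_iff by blast

text \<open>
  The unconstrained bound for \<open>g = f - n * K * penalty (t * n) (\<delta> * n) \<circ> h\<close>.  The derivative of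
  the penalty is at most \<open>2 / (\<delta> * n)\<close> and is Lipschitz with constant at most
  \<open>6 / (\<delta> * n)\<^sup>2\<close>; the chain and product rules then give \<open>N\<close>.
\<close>

theorem constrained_mean_field_upper_bound:
  fixes f h :: "real ^ 'n \<Rightarrow> real"
  assumes f: "C2_on_cube f" and h: "C2_on_cube h"
    and pos: "0 < t" "0 < \<delta>" "0 < \<epsilon>"
    and n: "n = real CARD('n)"
    and a: "a = sup_norm f"
    and c: "\<And>i j. c i j = sup_norm (partial2 i j f)"
    and \<beta>: "\<And>i. \<beta> i = sup_norm (partial i h)"
    and \<gamma>: "\<And>i j. \<gamma> i j = sup_norm (partial2 i j h)"
    and K: "K = ln 2 + 2 * a / n"
    and N: "\<And>i j. N i j = c i j + 2 * K * \<gamma> i j / \<delta> + 6 * K * \<beta> i * \<beta> j / (n * \<delta>\<^sup>2)"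
    and Df: "gradient_net f (\<epsilon> / 3) Df"
    and Dh: "gradient_net h (\<delta> * \<epsilon> / (6 * K)) Dh"
    and A: "A = {x \<in> cube_vertices. \<bar>h x\<bar> \<le> t * n}" "A \<noteq> {}"
    and M: "\<And>x. x \<in> unit_cube \<Longrightarrow> \<bar>h x\<bar> \<le> (t + \<delta>) * n \<Longrightarrow> f x - entropy_I x \<le> M"
  shows "ln (\<Sum>x\<in>A. exp (f x)) \<le> M
      + (log_plus (12 * K * sqrt (1 / n * (\<Sum>i\<in>UNIV. (\<beta> i)\<^sup>2)) / (\<delta> * \<epsilon>))
         + ln (real (card Df)) + ln (real (card Dh)))
      + n * \<epsilon> + 5 / 4 * (\<Sum>i\<in>UNIV. N i i)
      + sqrt ((a + n * K) / 8 * (\<Sum>i\<in>UNIV. \<Sum>j\<in>UNIV. (N i j)\<^sup>2))"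
proof -
  define \<tau> where "\<tau> = t * n"
  define \<kappa> where "\<kappa> = \<delta> * n"
  have n_pos: "0 < n" by (simp add: n)
  have \<tau>: "0 < \<tau>" and \<kappa>: "0 < \<kappa>" using pos n_pos by (simp_all add: \<tau>_def \<kappa>_def)
  have f_bound: "\<bar>f x\<bar> \<le> a" if "x \<in> unit_cube" for x
    unfolding a using C2_on_cubeD(1)[OF f] that by (rule abs_le_sup_norm)
  have a_nonneg: "0 \<le> a" unfolding a by (intro sup_norm_nonneg C2_on_cubeD(1) f)
  have K_pos: "0 < K" using a_nonneg n_pos by (simp add: K add_pos_nonneg)
  have h_bound: "\<bar>partial i h x\<bar> \<le> \<beta> i" if "x \<in> unit_cube" for i x
    unfolding \<beta> using C2_on_cubeD(2)[OF h] that by (rule abs_le_sup_norm)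
  have \<beta>_nonneg: "0 \<le> \<beta> i" for i unfolding \<beta> by (intro sup_norm_nonneg C2_on_cubeD(2) h)
  have \<gamma>_nonneg: "0 \<le> \<gamma> i j" for i j unfolding \<gamma> by (intro sup_norm_nonneg C2_on_cubeD(3) h)

  let ?P = "penalty \<tau> \<kappa>" and ?P' = "penalty_deriv \<tau> \<kappa>"
  define g where "g x = f x - n * K * ?P (h x)" for x
  define G where "G i x = partial i f x - n * K * ?P' (h x) * partial i h x" for i x

  have grad: "has_gradient g G"
    unfolding has_gradient_def
  proof
    fix x :: "real ^ 'n"
    assume x: "x \<in> unit_cube"
    have df: "(f has_derivative (\<lambda>v. \<Sum>i\<in>UNIV. partial i f x * v $ i)) (at x within unit_cube)"
      and dh: "(h has_derivative (\<lambda>v. \<Sum>i\<in>UNIV. partial i h x * v $ i)) (at x within unit_cube)"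
      using C2_on_cubeD(4)[OF f] C2_on_cubeD(4)[OF h] x by (simp_all add: has_gradient_def)
    have "((\<lambda>x. ?P (h x)) has_derivative (\<lambda>v. (\<Sum>i\<in>UNIV. partial i h x * v $ i) * ?P' (h x)))
        (at x within unit_cube)"
      using penalty_has_deriv[OF \<tau> \<kappa>] dh by (rule DERIV_compose_FDERIV)
    then have "(g has_derivative (\<lambda>v. (\<Sum>i\<in>UNIV. partial i f x * v $ i)
        - n * K * ((\<Sum>i\<in>UNIV. partial i h x * v $ i) * ?P' (h x)))) (at x within unit_cube)"
      unfolding g_def[abs_def] by (intro has_derivative_diff df has_derivative_mult_right)
    moreover have "(\<Sum>i\<in>UNIV. partial i f x * v $ i)
        - n * K * ((\<Sum>i\<in>UNIV. partial i h x * v $ i) * ?P' (h x)) = (\<Sum>i\<in>UNIV. G i x * v $ i)" for v :: "real ^ 'n"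
      by (simp only: sum_distrib_left sum_distrib_right sum_subtractf[symmetric])
         (simp add: G_def algebra_simps)
    ultimately show "(g has_derivative (\<lambda>v. \<Sum>i\<in>UNIV. G i x * v $ i)) (at x within unit_cube)"
      by simp
  qed

  have bound: "\<bar>g x\<bar> \<le> a + n * K" if "x \<in> unit_cube" for x
  proof -
    have "0 \<le> n * K * ?P (h x)" "n * K * ?P (h x) \<le> n * K"
      using penalty_bounds[OF \<tau> \<kappa>, of "h x"] n_pos K_pos by (auto intro!: mult_left_le)
    then show ?thesis using f_bound[OF that] unfolding g_def by linarith
  qed

  have lip: "lipschitz_on_cube (\<lambda>i. N i j) (G j)" for j
    unfolding lipschitz_on_cube_def
  proof (intro ballI)
    fix y z :: "real ^ 'n"
    assume y: "y \<in> unit_cube" and z: "z \<in> unit_cube"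
    let ?e = "\<lambda>i. \<bar>z $ i - y $ i\<bar>"
    have f_diff: "\<bar>partial j f z - partial j f y\<bar> \<le> (\<Sum>i\<in>UNIV. c i j * ?e i)"
      unfolding c by (rule lipschitz_on_cubeD[OF C2_on_cubeD(5)[OF f] y z])
    have h'_diff: "\<bar>partial j h z - partial j h y\<bar> \<le> (\<Sum>i\<in>UNIV. \<gamma> i j * ?e i)"
      unfolding \<gamma> by (rule lipschitz_on_cubeD[OF C2_on_cubeD(5)[OF h] y z])
    have h_diff: "\<bar>h z - h y\<bar> \<le> (\<Sum>i\<in>UNIV. \<beta> i * ?e i)"
      unfolding \<beta> by (rule lipschitz_on_cubeD[OF C2_on_cubeD(6)[OF h] y z])
    have "\<bar>?P' (h z) - ?P' (h y)\<bar> \<le> 4 / \<kappa>\<^sup>2 * \<bar>h z - h y\<bar>"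
      by (rule penalty_deriv_lipschitz[OF \<tau> \<kappa>])
    also have "\<dots> \<le> 6 / \<kappa>\<^sup>2 * (\<Sum>i\<in>UNIV. \<beta> i * ?e i)"
      by (intro mult_mono h_diff divide_right_mono) auto
    finally have P_diff: "\<bar>?P' (h z) - ?P' (h y)\<bar> \<le> 6 / \<kappa>\<^sup>2 * (\<Sum>i\<in>UNIV. \<beta> i * ?e i)" .
    have "?P' (h z) * partial j h z - ?P' (h y) * partial j h y
        = ?P' (h z) * (partial j h z - partial j h y) + (?P' (h z) - ?P' (h y)) * partial j h y"
      by (simp add: algebra_simps)
    then have "\<bar>?P' (h z) * partial j h z - ?P' (h y) * partial j h y\<bar>
        \<le> \<bar>?P' (h z)\<bar> * \<bar>partial j h z - partial j h y\<bar> + \<bar>?P' (h z) - ?P' (h y)\<bar> * \<bar>partial j h y\<bar>"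
      by (metis abs_mult abs_triangle_ineq)
    also have "\<dots> \<le> 2 / \<kappa> * (\<Sum>i\<in>UNIV. \<gamma> i j * ?e i) + 6 / \<kappa>\<^sup>2 * (\<Sum>i\<in>UNIV. \<beta> i * ?e i) * \<beta> j"
      using \<kappa> by (intro add_mono mult_mono penalty_deriv_bound[OF \<tau> \<kappa>] h'_diff P_diff h_bound y
          mult_nonneg_nonneg sum_nonneg \<beta>_nonneg) auto
    finally have Ph_diff: "\<bar>?P' (h z) * partial j h z - ?P' (h y) * partial j h y\<bar>
        \<le> 2 / \<kappa> * (\<Sum>i\<in>UNIV. \<gamma> i j * ?e i) + 6 / \<kappa>\<^sup>2 * (\<Sum>i\<in>UNIV. \<beta> i * ?e i) * \<beta> j" .
    have "G j z - G j y = (partial j f z - partial j f y)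
        - n * K * (?P' (h z) * partial j h z - ?P' (h y) * partial j h y)"
      by (simp add: G_def algebra_simps)
    then have "\<bar>G j z - G j y\<bar> \<le> \<bar>partial j f z - partial j f y\<bar>
        + \<bar>n * K * (?P' (h z) * partial j h z - ?P' (h y) * partial j h y)\<bar>"
      by linarith
    also have "\<dots> \<le> (\<Sum>i\<in>UNIV. c i j * ?e i)
        + n * K * (2 / \<kappa> * (\<Sum>i\<in>UNIV. \<gamma> i j * ?e i) + 6 / \<kappa>\<^sup>2 * (\<Sum>i\<in>UNIV. \<beta> i * ?e i) * \<beta> j)"
    proof (intro add_mono f_diff)
      have nK: "0 \<le> n * K" using n_pos K_pos by simp
      show "\<bar>n * K * (?P' (h z) * partial j h z - ?P' (h y) * partial j h y)\<bar>
          \<le> n * K * (2 / \<kappa> * (\<Sum>i\<in>UNIV. \<gamma> i j * ?e i) + 6 / \<kappa>\<^sup>2 * (\<Sum>i\<in>UNIV. \<beta> i * ?e i) * \<beta> j)"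
        unfolding abs_mult[of "n * K"] abs_of_nonneg[OF nK] by (intro mult_left_mono Ph_diff nK)
    qed
    also have "\<dots> = (\<Sum>i\<in>UNIV. N i j * ?e i)"
    proof -
      have "N i j = c i j + n * K * (2 / \<kappa>) * \<gamma> i j + n * K * (6 / \<kappa>\<^sup>2) * \<beta> j * \<beta> i" for i
        using n_pos pos by (simp add: N \<kappa>_def power2_eq_square mult_ac)
      then show ?thesis
        by (simp only: distrib_right sum.distrib) (simp add: sum_distrib_left sum_distrib_right distrib_left mult_ac)
    qed
    finally show "\<bar>G j z - G j y\<bar> \<le> (\<Sum>i\<in>UNIV. N i j * ?e i)" .
  qed

  \<comment> \<open>Outside the relaxed constraint set the full penalty brings \<open>g - entropy_I\<close> down to
    at most \<open>- a\<close>; at an admissible vertex \<open>f - entropy_I\<close> is at least \<open>-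
    a\<close>, since the entropy vanishes there.\<close>
  have sup: "g x - entropy_I x \<le> M" if x: "x \<in> unit_cube" for x
  proof (cases "\<bar>h x\<bar> \<le> (t + \<delta>) * n")
    case True
    have "0 \<le> n * K * ?P (h x)"
      using penalty_bounds[OF \<tau> \<kappa>, of "h x"] n_pos K_pos by simp
    then show ?thesis using M[OF x True] by (simp add: g_def)
  next
    case False
    then have "?P (h x) = 1"
      by (intro penalty_eq_1[OF \<tau> \<kappa>]) (simp add: \<tau>_def \<kappa>_def algebra_simps)
    then have "g x = f x - n * ln 2 - 2 * a"
      using n_pos by (simp add: g_def K field_simps)
    then have low: "g x - entropy_I x \<le> - a"
      using entropy_I_ge[OF x] f_bound[OF x] by (simp add: n)
    obtain x0 where x0: "x0 \<in> cube_vertices" "\<bar>h x0\<bar> \<le> t * n" using A by auto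
    have x0_cube: "x0 \<in> unit_cube" using x0 cube_vertices_subset by blast
    have "t * n \<le> (t + \<delta>) * n" using pos n_pos by simp
    then have "f x0 - entropy_I x0 \<le> M" using x0 by (intro M x0_cube) linarith
    then show ?thesis
      using low f_bound[OF x0_cube] by (simp add: entropy_I_vertex[OF x0(1)])
  qed

  define R where "R = 2 * K / \<delta>"
  define B where "B = sqrt (1 / n * (\<Sum>i\<in>UNIV. (\<beta> i)\<^sup>2))"
  have R: "0 < R" using K_pos pos by (simp add: R_def)
  have B: "0 \<le> B" using n_pos by (simp add: B_def sum_nonneg)
  obtain \<Gamma> where \<Gamma>: "finite \<Gamma>" "real (card \<Gamma>) \<le> max 1 (2 * R * B / (\<epsilon> / 3))"
    and \<Gamma>_net: "\<And>\<mu>. \<bar>\<mu>\<bar> \<le> R \<Longrightarrow> \<exists>\<nu>\<in>\<Gamma>. \<bar>\<nu>\<bar> \<le> R \<and> \<bar>\<mu> - \<nu>\<bar> * B \<le> \<epsilon> / 3"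
    using interval_net[OF R B, of "\<epsilon> / 3"] pos by auto
  define D where "D = (\<lambda>((d, e), \<nu>). d - \<nu> *\<^sub>R e) ` ((Df \<times> Dh) \<times> \<Gamma>)"
  have fin: "finite Df" "finite Dh" using Df Dh by (simp_all add: gradient_net_def)
  have D_fin: "finite D" unfolding D_def using fin \<Gamma>(1) by simp

  \<comment> \<open>A third of the error each for the net of \<open>f\<close>, the grid of scalars and the net of
    \<open>h\<close>.\<close>
  have net: "\<exists>d\<in>D. (\<Sum>i\<in>UNIV. \<bar>G i x - d $ i\<bar>) \<le> n * \<epsilon>" if x: "x \<in> unit_cube" for x
  proof -
    define \<mu> where "\<mu> = n * K * ?P' (h x)"
    have "\<bar>\<mu>\<bar> = n * K * \<bar>?P' (h x)\<bar>"
      using n_pos K_pos by (simp add: \<mu>_def abs_mult)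
    also have "\<dots> \<le> n * K * (2 / \<kappa>)"
      using n_pos K_pos by (intro mult_left_mono penalty_deriv_bound[OF \<tau> \<kappa>]) simp
    also have "\<dots> = R" using n_pos by (simp add: \<kappa>_def R_def)
    finally obtain \<nu> where \<nu>: "\<nu> \<in> \<Gamma>" "\<bar>\<nu>\<bar> \<le> R" "\<bar>\<mu> - \<nu>\<bar> * B \<le> \<epsilon> / 3"
      using \<Gamma>_net by blast
    obtain d where d: "d \<in> Df" "(\<Sum>i\<in>UNIV. \<bar>partial i f x - d $ i\<bar>) \<le> n * (\<epsilon> / 3)"
      using gradient_net_l1[OF Df x] pos by (auto simp: n)
    obtain e where e: "e \<in> Dh" "(\<Sum>i\<in>UNIV. \<bar>partial i h x - e $ i\<bar>) \<le> n * (\<delta> * \<epsilon> / (6 * K))"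
      using gradient_net_l1[OF Dh x] pos K_pos by (auto simp: n)
    have grad_h: "(\<Sum>i\<in>UNIV. \<bar>partial i h x\<bar>) \<le> n * B"
    proof -
      have "(\<Sum>i\<in>UNIV. \<bar>partial i h x\<bar>) \<le> (\<Sum>i\<in>UNIV. \<bar>\<beta> i\<bar>)"
        by (intro sum_mono) (simp add: h_bound x \<beta>_nonneg)
      then show ?thesis using sum_abs_le_l2[of \<beta>] by (simp add: B_def n)
    qed
    have "\<bar>G i x - (d - \<nu> *\<^sub>R e) $ i\<bar> \<le> \<bar>partial i f x - d $ i\<bar> + \<bar>\<mu> - \<nu>\<bar> * \<bar>partial i h x\<bar>
        + \<bar>\<nu>\<bar> * \<bar>partial i h x - e $ i\<bar>" for i
    proof -
      have "G i x - (d - \<nu> *\<^sub>R e) $ i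
          = (partial i f x - d $ i) - (\<mu> - \<nu>) * partial i h x - \<nu> * (partial i h x - e $ i)"
        by (simp add: G_def \<mu>_def algebra_simps)
      then show ?thesis unfolding abs_mult[symmetric] by linarith
    qed
    then have "(\<Sum>i\<in>UNIV. \<bar>G i x - (d - \<nu> *\<^sub>R e) $ i\<bar>)
        \<le> (\<Sum>i\<in>UNIV. \<bar>partial i f x - d $ i\<bar> + \<bar>\<mu> - \<nu>\<bar> * \<bar>partial i h x\<bar>
            + \<bar>\<nu>\<bar> * \<bar>partial i h x - e $ i\<bar>)"
      by (intro sum_mono)
    also have "\<dots> = (\<Sum>i\<in>UNIV. \<bar>partial i f x - d $ i\<bar>) + \<bar>\<mu> - \<nu>\<bar> * (\<Sum>i\<in>UNIV. \<bar>partial i h x\<bar>)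
        + \<bar>\<nu>\<bar> * (\<Sum>i\<in>UNIV. \<bar>partial i h x - e $ i\<bar>)"
      by (simp add: sum.distrib sum_distrib_left)
    also have "\<dots> \<le> n * (\<epsilon> / 3) + \<bar>\<mu> - \<nu>\<bar> * (n * B) + R * (n * (\<delta> * \<epsilon> / (6 * K)))"
      using R by (intro add_mono d(2) mult_mono e(2) grad_h \<nu>(2)) (auto intro: sum_nonneg)
    also have "\<bar>\<mu> - \<nu>\<bar> * (n * B) \<le> n * (\<epsilon> / 3)"
      using mult_left_mono[OF \<nu>(3), of n] n_pos by (simp add: mult_ac)
    also have "R * (n * (\<delta> * \<epsilon> / (6 * K))) = n * (\<epsilon> / 3)"
      using pos K_pos by (simp add: R_def)
    finally have "(\<Sum>i\<in>UNIV. \<bar>G i x - (d - \<nu> *\<^sub>R e) $ i\<bar>) \<le> n * \<epsilon>" by (simp add: mult.commute)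
    moreover have "d - \<nu> *\<^sub>R e \<in> D" unfolding D_def using d(1) e(1) \<nu>(1) by force
    ultimately show ?thesis by blast
  qed

  have card: "ln (real (card D)) \<le> log_plus (12 * K * B / (\<delta> * \<epsilon>)) + ln (real (card Df)) + ln (real (card Dh))"
  proof -
    have y: "2 * R * B / (\<epsilon> / 3) = 12 * K * B / (\<delta> * \<epsilon>)" by (simp add: R_def)
    have pos_f: "0 < real (card Df)" and pos_h: "0 < real (card Dh)"
      using gradient_net_card_pos[OF Df] gradient_net_card_pos[OF Dh] by simp_all
    have "D \<noteq> {}" using net[OF zero_in_unit_cube] by blast
    then have "0 < real (card D)" using D_fin by (simp add: card_gt_0_iff)
    moreover have "real (card D) \<le> max 1 (12 * K * B / (\<delta> * \<epsilon>)) * real (card Df) * real (card Dh)"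
    proof -
      have "card D \<le> card ((Df \<times> Dh) \<times> \<Gamma>)"
        unfolding D_def using fin \<Gamma>(1) by (intro card_image_le) simp
      then have "card D \<le> card Df * card Dh * card \<Gamma>"
        by (simp add: card_cartesian_product)
      then have "real (card D) \<le> real (card Df * card Dh * card \<Gamma>)"
        by (rule of_nat_mono)
      also have "\<dots> \<le> real (card Df) * real (card Dh) * max 1 (12 * K * B / (\<delta> * \<epsilon>))"
        using \<Gamma>(2) unfolding y of_nat_mult by (intro mult_left_mono) auto
      finally show ?thesis by (simp add: mult_ac)
    qed
    ultimately have "ln (real (card D)) \<le> ln (max 1 (12 * K * B / (\<delta> * \<epsilon>)) * real (card Df) * real (card Dh))"
      by (intro ln_mono)
    also have "\<dots> = log_plus (12 * K * B / (\<delta> * \<epsilon>)) + ln (real (card Df)) + ln (real (card Dh))"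
      unfolding log_plus_def using pos_f pos_h
      by (simp only: ln_mult_pos mult_pos_pos less_max_iff_disj zero_less_one simp_thms)
    finally show ?thesis .
  qed

  have "(\<Sum>x\<in>A. exp (f x)) = (\<Sum>x\<in>A. exp (g x))"
  proof (intro sum.cong refl)
    fix x assume "x \<in> A"
    then have "\<bar>h x\<bar> \<le> \<tau>" by (simp add: A(1) \<tau>_def)
    then show "exp (f x) = exp (g x)" by (simp add: g_def penalty_eq_0[OF \<tau> \<kappa>])
  qed
  also have "\<dots> \<le> (\<Sum>x\<in>cube_vertices. exp (g x))"
    using A(1) finite_cube_vertices by (intro sum_mono2) auto
  finally have "ln (\<Sum>x\<in>A. exp (f x)) \<le> ln (\<Sum>x\<in>cube_vertices. exp (g x))"
    using A finite_cube_vertices by (intro ln_mono) (auto intro!: sum_pos)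
  also have "\<dots> \<le> M + ln (card D) + n * \<epsilon> + 5 / 4 * (\<Sum>i\<in>UNIV. N i i)
      + sqrt ((a + n * K) / 8 * (\<Sum>i\<in>UNIV. \<Sum>j\<in>UNIV. (N i j)\<^sup>2))"
    using cube_vertices_subset
    by (intro mean_field_upper_bound[OF grad bound lip sup D_fin] net) auto
  finally show ?thesis using card unfolding B_def by linarith
qed

section \<open>Bernoulli product measures and the lower bound\<close>

definition bernoulli_weight :: "real ^ 'n \<Rightarrow> real ^ 'n \<Rightarrow> real" where
  "bernoulli_weight y x = (\<Prod>i\<in>UNIV. x $ i * y $ i + (1 - x $ i) * (1 - y $ i))"

lemma sum_bernoulli_weight: "(\<Sum>x\<in>cube_vertices. bernoulli_weight y x) = 1"
  using sum_cube_vertices_prod[of "\<lambda>i r. r * y $ i + (1 - r) * (1 - y $ i)"]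
  by (simp add: bernoulli_weight_def)

lemma bernoulli_factor_nonneg:
  assumes "y \<in> unit_cube" "x \<in> cube_vertices"
  shows "0 \<le> x $ i * y $ i + (1 - x $ i) * (1 - y $ i)"
proof -
  have "0 \<le> x $ i \<and> x $ i \<le> 1"
    using assms(2) cube_vertices_subset by (auto simp: unit_cube_def)
  with assms(1) show ?thesis by (simp add: unit_cube_def)
qed

lemma bernoulli_weight_nonneg:
  "y \<in> unit_cube \<Longrightarrow> x \<in> cube_vertices \<Longrightarrow> 0 \<le> bernoulli_weight y x"
  unfolding bernoulli_weight_def by (intro prod_nonneg ballI bernoulli_factor_nonneg)

lemma bernoulli_balance:
  "bernoulli_weight y (set_coord x i 1) * (1 - y $ i) = bernoulli_weight y (set_coord x i 0) * y $ i"
proof -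
  have "bernoulli_weight y (set_coord x i s) = (s * y $ i + (1 - s) * (1 - y $ i)) *
      (\<Prod>j\<in>UNIV - {i}. x $ j * y $ j + (1 - x $ j) * (1 - y $ j))" for s
    unfolding bernoulli_weight_def by (subst prod.remove[of UNIV i]) (auto intro!: prod.cong)
  then show ?thesis by simp
qed

text \<open>
  The coordinates of \<open>y\<close> are replaced by independent Bernoulli variables one at a time.  When
  coordinate \<open>i\<close> is replaced, the current point still has coordinate \<open>y $ i\<close>, so the hypothesis
  \<open>step\<close> applies to it.
\<close>

lemma bernoulli_expectation_le:
  fixes F :: "real ^ 'n \<Rightarrow> real"
  assumes y: "y \<in> unit_cube"
    and step: "\<And>i x. x \<in> unit_cube \<Longrightarrow> x $ i = y $ i \<Longrightarrow>
      y $ i * F (set_coord x i 1) + (1 - y $ i) * F (set_coord x i 0) \<le> F x + v i"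
  shows "(\<Sum>x\<in>cube_vertices. bernoulli_weight y x * F x) \<le> F y + (\<Sum>i\<in>UNIV. v i)"
proof -
  let ?P = "bernoulli_weight y"
  define mix where "mix S x = (\<chi> i. if i \<in> S then x $ i else y $ i)" for S and x :: "real ^ 'n"
  have "(\<Sum>x\<in>cube_vertices. ?P x * F (mix S x)) \<le> F y + (\<Sum>i\<in>S. v i)" if "finite S" for S
    using that
  proof induction
    case empty
    have "mix {} x = y" for x by (simp add: mix_def vec_eq_iff)
    then show ?case by (simp add: sum_bernoulli_weight flip: sum_distrib_right)
  next
    case (insert i S)
    have mix_set: "mix (insert i S) (set_coord x i s) = set_coord (mix S x) i s" for x s
      using insert.hyps by (auto simp: mix_def vec_eq_iff)
    have "(\<Sum>x\<in>cube_vertices. ?P x * F (mix (insert i S) x))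
        = (\<Sum>x\<in>cube_vertices. ?P x *
            (y $ i * F (set_coord (mix S x) i 1) + (1 - y $ i) * F (set_coord (mix S x) i 0)))"
      unfolding mix_set[symmetric]
      by (rule sum_resample_coord) (simp_all add: bernoulli_balance)
    also have "\<dots> \<le> (\<Sum>x\<in>cube_vertices. ?P x * (F (mix S x) + v i))"
    proof (intro sum_mono mult_left_mono step)
      fix x :: "real ^ 'n"
      assume x: "x \<in> cube_vertices"
      then show "mix S x \<in> unit_cube"
        using y cube_vertices_subset by (auto simp: mix_def unit_cube_def)
      show "mix S x $ i = y $ i"
        using insert.hyps by (simp add: mix_def)
      show "0 \<le> ?P x"
        using y x by (rule bernoulli_weight_nonneg)
    qed
    also have "\<dots> = (\<Sum>x\<in>cube_vertices. ?P x * F (mix S x)) + v i"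
      by (simp add: distrib_left sum.distrib sum_bernoulli_weight flip: sum_distrib_right)
    finally show ?case
      using insert by simp
  qed
  from this[of UNIV] show ?thesis
    by (simp add: mix_def)
qed

text \<open>
  For \<open>F x = (g x - g y)\<^sup>2\<close> the gain from randomising coordinate \<open>i\<close> with mean \<open>q\<close> is
  \<open>q * (1 - q)\<close> times a difference of two values of the \<open>i\<close>-th partial derivative \<open>H i\<close> of \<open>F\<close>,
  by the mean value theorem on either side of \<open>q\<close>; that difference is at most
  \<open>2 * (b i)\<^sup>2 + 4 * a * c i i\<close>.
\<close>

lemma bernoulli_second_moment_le:
  fixes g :: "real ^ 'n \<Rightarrow> real"
  assumes y: "y \<in> unit_cube" and grad: "has_gradient g G"
    and a: "\<And>x. x \<in> unit_cube \<Longrightarrow> \<bar>g x\<bar> \<le> a"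
    and b: "\<And>i x. x \<in> unit_cube \<Longrightarrow> \<bar>G i x\<bar> \<le> b i"
    and c: "\<And>i. lipschitz_on_cube (\<lambda>j. c j i) (G i)"
  shows "(\<Sum>x\<in>cube_vertices. bernoulli_weight y x * (g x - g y)\<^sup>2) \<le> (\<Sum>i\<in>UNIV. a * c i i + (b i)\<^sup>2)"
proof -
  define F where "F x = (g x - g y)\<^sup>2" for x
  define H where "H i x = 2 * (g x - g y) * G i x" for i x
  have F: "has_gradient F H"
    unfolding has_gradient_def
  proof
    fix x :: "real ^ 'n"
    assume "x \<in> unit_cube"
    then have "(g has_derivative (\<lambda>v. \<Sum>i\<in>UNIV. G i x * v $ i)) (at x within unit_cube)"
      using grad by (simp add: has_gradient_def)
    then show "(F has_derivative (\<lambda>v. \<Sum>i\<in>UNIV. H i x * v $ i)) (at x within unit_cube)"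
      unfolding F_def[abs_def] H_def
      by (auto intro!: derivative_eq_intros simp: sum_distrib_left mult_ac)
  qed
  have "y $ i * F (set_coord x i 1) + (1 - y $ i) * F (set_coord x i 0) \<le> F x + (a * c i i + (b i)\<^sup>2)"
    if x: "x \<in> unit_cube" and xy: "x $ i = y $ i" for i x
  proof -
    let ?q = "y $ i"
    have q: "0 \<le> ?q" "?q \<le> 1" using y by (auto simp: unit_cube_def)
    have sx: "set_coord x i ?q = x" using set_coord_self[of x i] xy by simp
    obtain r where r: "r \<in> {?q..1}" "F (set_coord x i 1) - F x = (1 - ?q) * H i (set_coord x i r)"
      using mean_value_coord[OF F x, of ?q 1 i] q sx by auto
    obtain s where s: "s \<in> {0..?q}" "F x - F (set_coord x i 0) = ?q * H i (set_coord x i s)"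
      using mean_value_coord[OF F x, of 0 ?q i] q sx by auto
    let ?r = "set_coord x i r" and ?s = "set_coord x i s"
    have r01: "r \<in> {0..1}" and s01: "s \<in> {0..1}" using r s q by auto
    have rs: "?r \<in> unit_cube" "?s \<in> unit_cube" using r01 s01 x by (auto intro: set_coord_in_cube)
    have b0: "0 \<le> b i" using b[OF y, of i] by linarith
    have a0: "0 \<le> a" using a[OF y] by linarith
    have "\<bar>r - s\<bar> \<le> 1" using r01 s01 by auto
    have dG: "\<bar>G i ?r - G i ?s\<bar> \<le> c i i"
    proof -
      have "\<bar>G i (set_coord x i 1) - G i (set_coord x i 0)\<bar> \<le> c i i * \<bar>1 - 0\<bar>"
        using x c by (intro lipschitz_coord) auto
      then have "0 \<le> c i i" by simp
      then have "c i i * \<bar>r - s\<bar> \<le> c i i"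
        using \<open>\<bar>r - s\<bar> \<le> 1\<close> by (intro mult_right_le_one_le) auto
      moreover have "\<bar>G i ?r - G i ?s\<bar> \<le> c i i * \<bar>r - s\<bar>"
        using x c r01 s01 by (intro lipschitz_coord)
      ultimately show ?thesis by linarith
    qed
    have dg: "\<bar>g ?r - g ?s\<bar> \<le> b i"
    proof -
      have "\<bar>g ?r - g ?s\<bar> \<le> b i * \<bar>r - s\<bar>"
        using has_gradient_imp_lipschitz[OF grad b] x r01 s01 by (intro lipschitz_coord)
      also have "\<dots> \<le> b i"
        using \<open>\<bar>r - s\<bar> \<le> 1\<close> b0 by (intro mult_right_le_one_le) auto
      finally show ?thesis .
    qed
    have "H i ?r - H i ?s = 2 * ((g ?r - g ?s) * G i ?r + (g ?s - g y) * (G i ?r - G i ?s))"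
      by (simp add: H_def algebra_simps)
    also have "(g ?r - g ?s) * G i ?r \<le> b i * b i"
      using mult_mono[OF dg b[OF rs(1), of i]] b0 abs_le_D1[of "(g ?r - g ?s) * G i ?r"]
      by (simp add: abs_mult)
    also have "(g ?s - g y) * (G i ?r - G i ?s) \<le> (2 * a) * c i i"
    proof -
      have "\<bar>g ?s - g y\<bar> \<le> 2 * a" using a[OF rs(2)] a[OF y] by linarith
      from mult_mono[OF this dG] show ?thesis
        using a0 abs_le_D1[of "(g ?s - g y) * (G i ?r - G i ?s)"] by (simp add: abs_mult)
    qed
    finally have dH: "H i ?r - H i ?s \<le> 2 * (b i * b i + 2 * a * c i i)" by simp
    have "?q * F (set_coord x i 1) + (1 - ?q) * F (set_coord x i 0) - F x
        = ?q * (F (set_coord x i 1) - F x) - (1 - ?q) * (F x - F (set_coord x i 0))"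
      by (simp add: algebra_simps)
    also have "\<dots> = ?q * (1 - ?q) * (H i ?r - H i ?s)"
      unfolding r(2) s(2) by (simp add: algebra_simps)
    also have "\<dots> \<le> ?q * (1 - ?q) * (2 * (b i * b i + 2 * a * c i i))"
      using q by (intro mult_left_mono dH) auto
    also have "\<dots> \<le> 1 / 4 * (2 * (b i * b i + 2 * a * c i i))"
      using dG a0 b0 by (intro mult_right_mono bernoulli_variance_le) auto
    also have "\<dots> \<le> a * c i i + (b i)\<^sup>2"
      using b0 by (simp add: power2_eq_square)
    finally show ?thesis by simp
  qed
  from bernoulli_expectation_le[OF y this] show ?thesis
    by (simp add: F_def)
qed

text \<open>
  By symmetry let \<open>v \<le> u\<close> be the two probabilities.  From \<open>ln r \<le> 2 * sqrt r\<close> at \<open>r = u / v\<close>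
  the left-hand side is at most \<open>u * v * 4 * (u / v)\<close>, that is, \<open>4 * u\<^sup>2\<close>.  At the endpoints the
  variance factor vanishes.
\<close>

lemma logit_sq_times_variance_le:
  fixes q :: real
  assumes q: "0 \<le> q" "q \<le> 1"
  shows "q * (1 - q) * (ln q - ln (1 - q))\<^sup>2 \<le> 4"
proof (cases "q = 0 \<or> q = 1")
  case False
  with q have q': "0 < q" "q < 1" by auto
  have key: "u * v * (ln u - ln v)\<^sup>2 \<le> 4" if uv: "0 < v" "v \<le> u" "u \<le> 1" for u v :: real
  proof -
    have r: "1 \<le> u / v" using uv by simp
    have "ln (u / v) = 2 * ln (sqrt (u / v))" using uv by (simp add: ln_sqrt)
    also have "\<dots> \<le> 2 * sqrt (u / v)"
    proof -
      have "ln (sqrt (u / v)) \<le> sqrt (u / v) - 1" using uv by (intro ln_le_minus_one) simp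
      then show ?thesis by simp
    qed
    finally have "(ln (u / v))\<^sup>2 \<le> (2 * sqrt (u / v))\<^sup>2"
      using r by (intro power_mono) auto
    then have "(ln u - ln v)\<^sup>2 \<le> 4 * (u / v)"
      using uv r by (simp add: ln_div power_mult_distrib)
    then have "u * v * (ln u - ln v)\<^sup>2 \<le> u * v * (4 * (u / v))"
      using uv by (intro mult_left_mono) auto
    also have "\<dots> = 4 * (u * u)" using uv by simp
    also have "\<dots> \<le> 4" using mult_mono[of u 1 u 1] uv by simp
    finally show ?thesis .
  qed
  show ?thesis
  proof (cases "1 - q \<le> q")
    case True
    then show ?thesis using key[of "1 - q" q] q' by simp
  next
    case False
    then show ?thesis using key[of q "1 - q"] q' by (simp add: mult.commute power2_commute)
  qed
qed auto

text \<open>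
  The affine extension of the log-density to the whole cube.  It is the logarithm of the density
  at every vertex of positive density: there a coordinate with \<open>y $ i\<close> equal to 0 or 1
  contributes \<open>ln 0\<close> only with the factor 0.
\<close>

definition bernoulli_log_weight :: "real ^ 'n \<Rightarrow> real ^ 'n \<Rightarrow> real" where
  "bernoulli_log_weight y x = (\<Sum>i\<in>UNIV. x $ i * ln (y $ i) + (1 - x $ i) * ln (1 - y $ i))"

lemma bernoulli_log_weight_self: "bernoulli_log_weight y y = entropy_I y"
  by (simp add: bernoulli_log_weight_def entropy_I_def)

lemma bernoulli_weight_eq_exp:
  assumes y: "y \<in> unit_cube" and x: "x \<in> cube_vertices" and pos: "bernoulli_weight y x \<noteq> 0"
  shows "bernoulli_weight y x = exp (bernoulli_log_weight y x)"
proof -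
  have "x $ i * y $ i + (1 - x $ i) * (1 - y $ i) = exp (x $ i * ln (y $ i) + (1 - x $ i) * ln (1 - y $ i))"
    for i
  proof -
    have "x $ i * y $ i + (1 - x $ i) * (1 - y $ i) \<noteq> 0"
      using pos by (simp add: bernoulli_weight_def)
    with bernoulli_factor_nonneg[OF y x, of i]
    have "0 < x $ i * y $ i + (1 - x $ i) * (1 - y $ i)" by linarith
    moreover have "x $ i = 0 \<or> x $ i = 1" using x by (simp add: cube_vertices_def)
    ultimately show ?thesis by auto
  qed
  then show ?thesis
    by (simp add: bernoulli_weight_def bernoulli_log_weight_def exp_sum)
qed

lemma bernoulli_log_weight_second_moment_le:
  fixes y :: "real ^ 'n"
  assumes y: "y \<in> unit_cube"
  shows "(\<Sum>x\<in>cube_vertices. bernoulli_weight y x * (bernoulli_log_weight y x - entropy_I y)\<^sup>2)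
    \<le> 4 * real CARD('n)"
proof -
  let ?l = "bernoulli_log_weight y"
  have "y $ i * (?l (set_coord x i 1) - entropy_I y)\<^sup>2 + (1 - y $ i) * (?l (set_coord x i 0) - entropy_I y)\<^sup>2
      \<le> (?l x - entropy_I y)\<^sup>2 + 4" if x: "x \<in> unit_cube" "x $ i = y $ i" for x i
  proof -
    define \<rho> where "\<rho> = ln (y $ i) - ln (1 - y $ i)"
    have l: "?l (set_coord x i s) = ?l x + (s - y $ i) * \<rho>" for s
    proof -
      have "?l (set_coord x i s) - ?l x = (\<Sum>j\<in>UNIV. if j = i then (s - y $ i) * \<rho> else 0)"
        unfolding bernoulli_log_weight_def sum_subtractf[symmetric] \<rho>_def
        by (intro sum.cong) (auto simp: x(2) algebra_simps)
      then show ?thesis by simp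
    qed
    have "y $ i * (?l (set_coord x i 1) - entropy_I y)\<^sup>2 + (1 - y $ i) * (?l (set_coord x i 0) - entropy_I y)\<^sup>2
        = (?l x - entropy_I y)\<^sup>2 + y $ i * (1 - y $ i) * \<rho>\<^sup>2"
      unfolding l by (simp add: power2_eq_square algebra_simps)
    also have "y $ i * (1 - y $ i) * \<rho>\<^sup>2 \<le> 4"
      unfolding \<rho>_def using y by (intro logit_sq_times_variance_le) (auto simp: unit_cube_def)
    finally show ?thesis by simp
  qed
  from bernoulli_expectation_le[OF y, where F = "\<lambda>x. (?l x - entropy_I y)\<^sup>2" and v = "\<lambda>_. 4", OF this]
  show ?thesis by (simp add: bernoulli_log_weight_self)
qed

text \<open>
  The strict inequality in the event keeps the statement true for \<open>v = 0\<close>.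
\<close>

lemma chebyshev_one_sixth:
  fixes w F :: "'a \<Rightarrow> real"
  assumes V: "finite V" and w: "\<And>x. x \<in> V \<Longrightarrow> 0 \<le> w x"
    and moment: "(\<Sum>x\<in>V. w x * (F x)\<^sup>2) \<le> v"
  shows "(\<Sum>x\<in>{x \<in> V. sqrt 6 * sqrt v < \<bar>F x\<bar>}. w x) \<le> 1 / 6"
proof -
  let ?B = "{x \<in> V. sqrt 6 * sqrt v < \<bar>F x\<bar>}"
  have v: "0 \<le> v"
    using sum_nonneg[of V "\<lambda>x. w x * (F x)\<^sup>2"] w moment by fastforce
  have sub: "(\<Sum>x\<in>?B. w x * (F x)\<^sup>2) \<le> v"
    using sum_mono2[OF V, of ?B "\<lambda>x. w x * (F x)\<^sup>2"] w moment by fastforce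
  show ?thesis
  proof (cases "v = 0")
    case True
    have "w x = 0" if "x \<in> ?B" for x
    proof -
      have "w x * (F x)\<^sup>2 \<le> (\<Sum>x\<in>?B. w x * (F x)\<^sup>2)"
        using that V w by (intro member_le_sum) auto
      then have "w x * (F x)\<^sup>2 \<le> 0" using sub True by linarith
      moreover have "0 < (F x)\<^sup>2" using that True by simp
      ultimately show "w x = 0"
        using w[of x] that by (auto simp: mult_le_0_iff)
    qed
    then show ?thesis by simp
  next
    case False
    have "6 * v * (\<Sum>x\<in>?B. w x) \<le> (\<Sum>x\<in>?B. w x * (F x)\<^sup>2)"
      unfolding sum_distrib_left
    proof (rule sum_mono)
      fix x assume x: "x \<in> ?B"
      then have "(sqrt 6 * sqrt v)\<^sup>2 \<le> \<bar>F x\<bar>\<^sup>2"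
        using v by (intro power_mono) auto
      then have "6 * v \<le> (F x)\<^sup>2" using v by (simp add: power_mult_distrib)
      then show "6 * v * w x \<le> w x * (F x)\<^sup>2"
        using w x by (subst mult.commute) (auto intro: mult_left_mono)
    qed
    then have "v * (6 * (\<Sum>x\<in>?B. w x)) \<le> v * 1" using sub by (simp add: mult_ac)
    then show ?thesis using v False by (subst (asm) mult_le_cancel_left_pos) auto
  qed
qed

text \<open>
  The three exceptional events have total probability at most 1/2.  On the remaining vertices of
  positive weight, \<open>f x\<close> exceeds the log-density of \<open>x\<close> by at least the constant \<open>C\<close>, so their
  sum of \<open>exp f\<close> is at least \<open>exp C / 2\<close>.
\<close>

theorem mean_field_lower_bound:
  fixes f h :: "real ^ 'n \<Rightarrow> real"
  assumes y: "y \<in> unit_cube"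
    and vf: "(\<Sum>x\<in>cube_vertices. bernoulli_weight y x * (f x - f y)\<^sup>2) \<le> vf"
    and vh: "(\<Sum>x\<in>cube_vertices. bernoulli_weight y x * (h x - h y)\<^sup>2) \<le> vh"
    and hy: "\<bar>h y\<bar> \<le> T - sqrt 6 * sqrt vh"
  shows "{x \<in> cube_vertices. \<bar>h x\<bar> \<le> T} \<noteq> {}"
    and "f y - entropy_I y - sqrt 6 * sqrt (4 * real CARD('n)) - sqrt 6 * sqrt vf - ln 2
      \<le> ln (\<Sum>x\<in>{x \<in> cube_vertices. \<bar>h x\<bar> \<le> T}. exp (f x))"
proof -
  let ?V = "cube_vertices :: (real ^ 'n) set"
  let ?P = "bernoulli_weight y"
  let ?A = "{x \<in> ?V. \<bar>h x\<bar> \<le> T}"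
  define vl where "vl = 4 * real CARD('n)"
  let ?Bf = "{x \<in> ?V. sqrt 6 * sqrt vf < \<bar>f x - f y\<bar>}"
  let ?Bh = "{x \<in> ?V. sqrt 6 * sqrt vh < \<bar>h x - h y\<bar>}"
  let ?Bl = "{x \<in> ?V. sqrt 6 * sqrt vl < \<bar>bernoulli_log_weight y x - entropy_I y\<bar>}"
  define good where "good = ?V - (?Bf \<union> ?Bh \<union> ?Bl)"
  note V = finite_cube_vertices[where 'n = 'n]
  have P: "0 \<le> ?P x" if "x \<in> ?V" for x
    using y that by (rule bernoulli_weight_nonneg)
  have "sum ?P (?Bf \<union> ?Bh \<union> ?Bl) \<le> sum ?P (?Bf \<union> ?Bh) + sum ?P ?Bl"
    using V P by (subst sum_Un) (auto intro!: sum_nonneg)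
  also have "sum ?P (?Bf \<union> ?Bh) \<le> sum ?P ?Bf + sum ?P ?Bh"
    using V P by (subst sum_Un) (auto intro!: sum_nonneg)
  also have "sum ?P ?Bf \<le> 1 / 6" by (rule chebyshev_one_sixth[OF V P vf])
  also have "sum ?P ?Bh \<le> 1 / 6" by (rule chebyshev_one_sixth[OF V P vh])
  also have "sum ?P ?Bl \<le> 1 / 6"
    unfolding vl_def
    by (rule chebyshev_one_sixth[OF V P bernoulli_log_weight_second_moment_le[OF y]])
  finally have "sum ?P (?Bf \<union> ?Bh \<union> ?Bl) \<le> 1 / 2" by simp
  moreover have "sum ?P good = 1 - sum ?P (?Bf \<union> ?Bh \<union> ?Bl)"
    unfolding good_def using V by (subst sum_diff) (auto simp: sum_bernoulli_weight)
  ultimately have good_half: "1 / 2 \<le> sum ?P good" by linarith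
  have good_sub: "good \<subseteq> ?A"
  proof
    fix x assume "x \<in> good"
    then have "x \<in> ?V" "\<bar>h x - h y\<bar> \<le> sqrt 6 * sqrt vh" by (auto simp: good_def)
    with hy show "x \<in> ?A" by auto
  qed
  have "good \<noteq> {}" using good_half by force
  then show ne: "?A \<noteq> {}" using good_sub by blast
  define C where "C = f y - entropy_I y - sqrt 6 * sqrt vl - sqrt 6 * sqrt vf"
  have ptw: "exp C * ?P x \<le> exp (f x)" if x: "x \<in> good" for x
  proof (cases "?P x = 0")
    case False
    have V_x: "x \<in> ?V" using x by (simp add: good_def)
    have "\<bar>f x - f y\<bar> \<le> sqrt 6 * sqrt vf" "\<bar>bernoulli_log_weight y x - entropy_I y\<bar> \<le> sqrt 6 * sqrt vl"
      using x by (auto simp: good_def)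
    then have "C + bernoulli_log_weight y x \<le> f x"
      unfolding C_def by linarith
    then show ?thesis
      by (simp add: bernoulli_weight_eq_exp[OF y V_x False] flip: exp_add)
  qed simp
  have "exp (C - ln 2) = exp C * (1 / 2)" by (simp add: exp_diff)
  also have "\<dots> \<le> exp C * sum ?P good" using good_half by (intro mult_left_mono) auto
  also have "\<dots> \<le> (\<Sum>x\<in>good. exp (f x))"
    unfolding sum_distrib_left by (intro sum_mono ptw)
  also have "\<dots> \<le> (\<Sum>x\<in>?A. exp (f x))"
    using good_sub V by (intro sum_mono2) auto
  finally have "exp (C - ln 2) \<le> (\<Sum>x\<in>?A. exp (f x))" .
  then have "C - ln 2 \<le> ln (\<Sum>x\<in>?A. exp (f x))"
    using ne V by (subst ln_ge_iff) (auto intro!: sum_pos)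
  then show "f y - entropy_I y - sqrt 6 * sqrt (4 * real CARD('n)) - sqrt 6 * sqrt vf - ln 2
      \<le> ln (\<Sum>x\<in>?A. exp (f x))"
    by (simp add: C_def vl_def)
qed

section \<open>The two-sided estimate\<close>

text \<open>
  Every summand on the right is nonnegative, and the large radicand there contains
  \<open>l / 4\<close> times the sum of the \<open>(N i j)\<^sup>2\<close>, hence dominates the radicand on the left.
\<close>

lemma mean_field_error_le:
  fixes m :: "'n::finite \<Rightarrow> real" and N :: "'n \<Rightarrow> 'n \<Rightarrow> real"
  assumes n: "0 \<le> n" and \<epsilon>: "0 \<le> \<epsilon>" and l: "0 \<le> l"
    and m: "\<And>i. 0 \<le> m i" and N: "\<And>i j. 0 \<le> N i j"
  shows "n * \<epsilon> + 5 / 4 * (\<Sum>i\<in>UNIV. N i i) + sqrt (l / 8 * (\<Sum>i\<in>UNIV. \<Sum>j\<in>UNIV. (N i j)\<^sup>2))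
    \<le> 1 / 4 * sqrt (n * (\<Sum>i\<in>UNIV. (m i)\<^sup>2)) * \<epsilon> + 3 * n * \<epsilon>
      + (4 * sqrt ((\<Sum>i\<in>UNIV. l * N i i + (m i)\<^sup>2)
            + 1 / 4 * (\<Sum>i\<in>UNIV. \<Sum>j\<in>UNIV. l * (N i j)\<^sup>2 + m i * m j * N i j + 4 * m i * N i j))
        + 1 / 4 * sqrt (\<Sum>i\<in>UNIV. (m i)\<^sup>2) * sqrt (\<Sum>i\<in>UNIV. (N i i)\<^sup>2)
        + 3 * (\<Sum>i\<in>UNIV. N i i) + ln 2)"
proof -
  define Q where "Q = (\<Sum>i\<in>UNIV. \<Sum>j\<in>UNIV. (N i j)\<^sup>2)"
  define X where "X = (\<Sum>i\<in>UNIV. l * N i i + (m i)\<^sup>2)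
    + 1 / 4 * (\<Sum>i\<in>UNIV. \<Sum>j\<in>UNIV. l * (N i j)\<^sup>2 + m i * m j * N i j + 4 * m i * N i j)"
  have Q: "0 \<le> Q" unfolding Q_def by (intro sum_nonneg) simp
  have "l * Q \<le> (\<Sum>i\<in>UNIV. \<Sum>j\<in>UNIV. l * (N i j)\<^sup>2 + m i * m j * N i j + 4 * m i * N i j)"
    unfolding Q_def sum_distrib_left using m N by (intro sum_mono) simp
  moreover have "0 \<le> (\<Sum>i\<in>UNIV. l * N i i + (m i)\<^sup>2)"
    using l N by (intro sum_nonneg) simp
  moreover have "0 \<le> l * Q" using l Q by simp
  ultimately have "l / 8 * Q \<le> X" "0 \<le> X" unfolding X_def by simp_all
  then have "sqrt (l / 8 * Q) \<le> 4 * sqrt X"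
    using real_sqrt_le_mono[of "l / 8 * Q" X] real_sqrt_ge_zero[of X] by linarith
  moreover have "n * \<epsilon> \<le> 1 / 4 * sqrt (n * (\<Sum>i\<in>UNIV. (m i)\<^sup>2)) * \<epsilon> + 3 * n * \<epsilon>"
  proof -
    have "0 \<le> 1 / 4 * sqrt (n * (\<Sum>i\<in>UNIV. (m i)\<^sup>2)) * \<epsilon>" "0 \<le> n * \<epsilon>"
      using n \<epsilon> by (simp_all add: sum_nonneg)
    then show ?thesis by linarith
  qed
  moreover have "0 \<le> 1 / 4 * sqrt (\<Sum>i\<in>UNIV. (m i)\<^sup>2) * sqrt (\<Sum>i\<in>UNIV. (N i i)\<^sup>2)"
    by (simp add: sum_nonneg)
  moreover have "0 \<le> (\<Sum>i\<in>UNIV. N i i)" using N by (intro sum_nonneg) simp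
  moreover have "0 \<le> ln (2 :: real)" by simp
  ultimately show ?thesis unfolding X_def Q_def by linarith
qed

theorem theorem3p1:
  fixes f h :: "real ^ 'n \<Rightarrow> real"
    and t n a \<alpha> K :: real
    and b \<beta> :: "'n \<Rightarrow> real"
    and c \<gamma> :: "'n \<Rightarrow> 'n \<Rightarrow> real"
    and Df Dh :: "real \<Rightarrow> (real ^ 'n) set"
  assumes f: "C2_on_cube f"
    and h: "C2_on_cube h"
    and t: "t > 0"
    and n: "n = real CARD('n)"
    and a: "a = sup_norm f"
    and b: "\<And>i. b i = sup_norm (partial i f)"
    and c: "\<And>i j. c i j = sup_norm (partial2 i j f)"
    and \<alpha>: "\<alpha> = sup_norm h"
    and \<beta>: "\<And>i. \<beta> i = sup_norm (partial i h)"
    and \<gamma>: "\<And>i j. \<gamma> i j = sup_norm (partial2 i j h)"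
    and Df: "\<And>\<epsilon>. \<epsilon> > 0 \<Longrightarrow> gradient_net f \<epsilon> (Df \<epsilon>)"
    and Dh: "\<And>\<epsilon>. \<epsilon> > 0 \<Longrightarrow> gradient_net h \<epsilon> (Dh \<epsilon>)"
    and K: "K = ln 2 + 2 * a / n"
  shows
    "(\<forall>\<delta>>0. \<forall>\<epsilon>>0.
       (let l = a + n * K;
            m = (\<lambda>i. b i + 2 * K * \<beta> i / \<delta>);
            N = (\<lambda>i j. c i j + 2 * K * \<gamma> i j / \<delta> + 6 * K * \<beta> i * \<beta> j / (n * \<delta>\<^sup>2));
            complexity =
              1 / 4 * sqrt (n * (\<Sum>i\<in>UNIV. (m i)\<^sup>2)) * \<epsilon> + 3 * n * \<epsilon>
              + log_plus (12 * K * sqrt (1 / n * (\<Sum>i\<in>UNIV. (\<beta> i)\<^sup>2)) / (\<delta> * \<epsilon>))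
              + ln (real (card (Df (\<epsilon> / 3))))
              + ln (real (card (Dh (\<delta> * \<epsilon> / (6 * K)))));
            smoothness =
              4 * sqrt ((\<Sum>i\<in>UNIV. l * N i i + (m i)\<^sup>2)
                        + 1 / 4 * (\<Sum>i\<in>UNIV. \<Sum>j\<in>UNIV.
                             l * (N i j)\<^sup>2 + m i * m j * N i j + 4 * m i * N i j))
              + 1 / 4 * sqrt (\<Sum>i\<in>UNIV. (m i)\<^sup>2) * sqrt (\<Sum>i\<in>UNIV. (N i i)\<^sup>2)
              + 3 * (\<Sum>i\<in>UNIV. N i i) + ln 2
        in constrained_free_energy f h t
             \<le> constrained_sup f h (t + \<delta>) + ereal complexity + ereal smoothness))
     \<and>
     (let \<delta>0 = sqrt 6 / n * sqrt (\<Sum>i\<in>UNIV. \<alpha> * \<gamma> i i + (\<beta> i)\<^sup>2);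
          \<epsilon>0 = 2 * sqrt (6 / n);
          \<eta>0 = sqrt 6 / n * sqrt (\<Sum>i\<in>UNIV. a * c i i + (b i)\<^sup>2)
      in constrained_free_energy f h t
           \<ge> constrained_sup f h (t - \<delta>0) - ereal (\<epsilon>0 * n) - ereal (\<eta>0 * n) - ereal (ln 2))"
proof -
  define A where "A = {x \<in> cube_vertices. \<bar>h x\<bar> \<le> t * n}"
  have n_pos: "0 < n" by (simp add: n)
  have energy: "constrained_free_energy f h t = (if A = {} then - \<infinity> else ereal (ln (\<Sum>x\<in>A. exp (f x))))"
    by (simp add: constrained_free_energy_def A_def n Let_def)
  have f_le: "\<bar>f x\<bar> \<le> a" and h_le: "\<bar>h x\<bar> \<le> \<alpha>"
    and df_le: "\<bar>partial i f x\<bar> \<le> b i" and dh_le: "\<bar>partial i h x\<bar> \<le> \<beta> i"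
    if "x \<in> unit_cube" for x i
    unfolding a b \<alpha> \<beta> using that
    by (intro abs_le_sup_norm C2_on_cubeD(1,2) f h; assumption)+
  have nonneg: "0 \<le> a" "\<And>i. 0 \<le> b i" "\<And>i j. 0 \<le> c i j" "\<And>i. 0 \<le> \<beta> i" "\<And>i j. 0 \<le> \<gamma> i j"
    unfolding a b c \<beta> \<gamma> by (intro sup_norm_nonneg C2_on_cubeD(1-3) f h)+
  have K_pos: "0 < K" using nonneg(1) n_pos by (simp add: K add_pos_nonneg)

  have upper: "constrained_free_energy f h t \<le> constrained_sup f h (t + \<delta>)
      + ereal (1 / 4 * sqrt (n * (\<Sum>i\<in>UNIV. (m i)\<^sup>2)) * \<epsilon> + 3 * n * \<epsilon>
              + log_plus (12 * K * sqrt (1 / n * (\<Sum>i\<in>UNIV. (\<beta> i)\<^sup>2)) / (\<delta> * \<epsilon>))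
              + ln (real (card (Df (\<epsilon> / 3))))
              + ln (real (card (Dh (\<delta> * \<epsilon> / (6 * K))))))
      + ereal (4 * sqrt ((\<Sum>i\<in>UNIV. l * N i i + (m i)\<^sup>2)
                        + 1 / 4 * (\<Sum>i\<in>UNIV. \<Sum>j\<in>UNIV.
                             l * (N i j)\<^sup>2 + m i * m j * N i j + 4 * m i * N i j))
              + 1 / 4 * sqrt (\<Sum>i\<in>UNIV. (m i)\<^sup>2) * sqrt (\<Sum>i\<in>UNIV. (N i i)\<^sup>2)
              + 3 * (\<Sum>i\<in>UNIV. N i i) + ln 2)"
    (is "_ \<le> _ + ereal ?C + ereal ?S")
    if pos: "0 < \<delta>" "0 < \<epsilon>" and l: "l = a + n * K" and m: "m = (\<lambda>i. b i + 2 * K * \<beta> i / \<delta>)"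
      and N: "N = (\<lambda>i j. c i j + 2 * K * \<gamma> i j / \<delta> + 6 * K * \<beta> i * \<beta> j / (n * \<delta>\<^sup>2))"
    for \<delta> \<epsilon> l m N
  proof (cases "A = {}")
    case True
    then show ?thesis by (simp add: energy)
  next
    case False
    have le_sup: "ereal (f x - entropy_I x) \<le> constrained_sup f h (t + \<delta>)"
      if "x \<in> unit_cube" "\<bar>h x\<bar> \<le> (t + \<delta>) * n" for x
      unfolding constrained_sup_def using that by (intro SUP_upper) (simp add: n)
    show ?thesis
    proof (cases "constrained_sup f h (t + \<delta>)")
      case PInf
      then show ?thesis by simp
    next
      case MInf
      obtain x where x: "x \<in> cube_vertices" "\<bar>h x\<bar> \<le> t * n" using False by (auto simp: A_def)
      have "t * n \<le> (t + \<delta>) * n" using pos n_pos by simp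
      then have "ereal (f x - entropy_I x) \<le> constrained_sup f h (t + \<delta>)"
        using x cube_vertices_subset by (intro le_sup) auto
      then show ?thesis using MInf by simp
    next
      case (real M)
      have "ln (\<Sum>x\<in>A. exp (f x)) \<le> M
          + (log_plus (12 * K * sqrt (1 / n * (\<Sum>i\<in>UNIV. (\<beta> i)\<^sup>2)) / (\<delta> * \<epsilon>))
             + ln (real (card (Df (\<epsilon> / 3)))) + ln (real (card (Dh (\<delta> * \<epsilon> / (6 * K))))))
          + n * \<epsilon> + 5 / 4 * (\<Sum>i\<in>UNIV. N i i)
          + sqrt ((a + n * K) / 8 * (\<Sum>i\<in>UNIV. \<Sum>j\<in>UNIV. (N i j)\<^sup>2))"
      proof (rule constrained_mean_field_upper_bound[OF f h t pos n a c \<beta> \<gamma> K])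
        show "f x - entropy_I x \<le> M" if "x \<in> unit_cube" "\<bar>h x\<bar> \<le> (t + \<delta>) * n" for x
          using le_sup[OF that] real by simp
      qed (use pos K_pos False in \<open>auto simp: N A_def intro!: Df Dh\<close>)
      moreover have "n * \<epsilon> + 5 / 4 * (\<Sum>i\<in>UNIV. N i i) + sqrt (l / 8 * (\<Sum>i\<in>UNIV. \<Sum>j\<in>UNIV. (N i j)\<^sup>2))
          \<le> 1 / 4 * sqrt (n * (\<Sum>i\<in>UNIV. (m i)\<^sup>2)) * \<epsilon> + 3 * n * \<epsilon> + ?S"
      proof (rule mean_field_error_le)
        show "0 \<le> n" "0 \<le> \<epsilon>" "0 \<le> l" using n_pos pos K_pos nonneg(1) by (simp_all add: l)
        show "0 \<le> m i" for i
          using nonneg K_pos pos by (simp add: m)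
        show "0 \<le> N i j" for i j
          using nonneg K_pos pos n_pos by (simp add: N)
      qed
      ultimately have "ln (\<Sum>x\<in>A. exp (f x)) \<le> M + ?C + ?S"
        unfolding l by linarith
      then show ?thesis using False real by (simp add: energy)
    qed
  qed

  define vh where "vh = (\<Sum>i\<in>UNIV. \<alpha> * \<gamma> i i + (\<beta> i)\<^sup>2)"
  define vf where "vf = (\<Sum>i\<in>UNIV. a * c i i + (b i)\<^sup>2)"
  have lower: "constrained_sup f h (t - sqrt 6 / n * sqrt vh) - ereal (2 * sqrt (6 / n) * n)
      - ereal (sqrt 6 / n * sqrt vf * n) - ereal (ln 2) \<le> constrained_free_energy f h t"
  proof -
    let ?Y = "{y \<in> unit_cube. \<bar>h y\<bar> \<le> (t - sqrt 6 / n * sqrt vh) * n}"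
    have bound: "A \<noteq> {}" "f y - entropy_I y \<le> ln (\<Sum>x\<in>A. exp (f x))
        + 2 * sqrt (6 / n) * n + sqrt 6 / n * sqrt vf * n + ln 2"
      if y: "y \<in> ?Y" for y
    proof -
      have cube: "y \<in> unit_cube" using y by simp
      have mf: "(\<Sum>x\<in>cube_vertices. bernoulli_weight y x * (f x - f y)\<^sup>2) \<le> vf"
        unfolding vf_def
        by (rule bernoulli_second_moment_le[OF cube C2_on_cubeD(4)[OF f] f_le df_le])
           (auto simp: c intro: C2_on_cubeD(5)[OF f])
      have mh: "(\<Sum>x\<in>cube_vertices. bernoulli_weight y x * (h x - h y)\<^sup>2) \<le> vh"
        unfolding vh_def
        by (rule bernoulli_second_moment_le[OF cube C2_on_cubeD(4)[OF h] h_le dh_le])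
           (auto simp: \<gamma> intro: C2_on_cubeD(5)[OF h])
      have hy: "\<bar>h y\<bar> \<le> t * n - sqrt 6 * sqrt vh"
        using y n_pos by (simp add: left_diff_distrib)
      note bounds = mean_field_lower_bound[OF cube mf mh hy]
      show "A \<noteq> {}" using bounds(1) by (simp add: A_def)
      have "sqrt 6 * sqrt (4 * real CARD('n)) = 2 * sqrt (6 / n) * n"
      proof -
        have "sqrt 6 * sqrt (4 * n) = sqrt ((2 * n)\<^sup>2 * (6 / n))"
          using n_pos by (simp add: power2_eq_square flip: real_sqrt_mult)
        also have "\<dots> = 2 * n * sqrt (6 / n)"
          using n_pos by (subst real_sqrt_mult, subst real_sqrt_abs) simp
        finally show ?thesis by (simp add: n)
      qed
      then show "f y - entropy_I y \<le> ln (\<Sum>x\<in>A. exp (f x))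
          + 2 * sqrt (6 / n) * n + sqrt 6 / n * sqrt vf * n + ln 2"
        using bounds(2) n_pos by (simp add: A_def)
    qed
    show ?thesis
    proof (cases "?Y = {}")
      case True
      then have "constrained_sup f h (t - sqrt 6 / n * sqrt vh) = - \<infinity>"
        by (simp only: constrained_sup_def n[symmetric]) (simp add: bot_ereal_def)
      then show ?thesis by simp
    next
      case False
      then have A: "A \<noteq> {}" using bound(1) by blast
      have "constrained_sup f h (t - sqrt 6 / n * sqrt vh) \<le> ereal (ln (\<Sum>x\<in>A. exp (f x))
          + 2 * sqrt (6 / n) * n + sqrt 6 / n * sqrt vf * n + ln 2)"
        unfolding constrained_sup_def n[symmetric]
        by (intro SUP_least) (use bound(2) in simp)
      then show ?thesis
        using A by (cases "constrained_sup f h (t - sqrt 6 / n * sqrt vh)") (simp_all add: energy)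
    qed
  qed

  show ?thesis
    unfolding Let_def
    using upper lower unfolding vh_def vf_def by blast
qed

end
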